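(* Let $\Phi_0,\dots,\Phi_3$ be simultaneously diagonalizable by the same unitary transformation, with eigenvalues $\{\lambda_{\ell,k}\}_{1\le k\le N_x}$, $|\lambda_{\ell,k}|<1$. Then the worst-case convergence factor $c_f$ of four-level MGRIT (V-cycle) with F-relaxation is bounded by $$c_f\le\sqrt{\|\mathcal{E}_F^{n_\ell=4,\Delta}\|_1\,\|\mathcal{E}_F^{n_\ell=4,\Delta}\|_\infty},$$ and the two norms are given analytically as $$\|\mathcal{E}_F^{n_\ell=4,\Delta}\|_1=\max_{\substack{1\le k\le N_x\\0\le d\le m_1m_2-1}}s_d^{\mathrm{col}}(k),\qquad\|\mathcal{E}_F^{n_\ell=4,\Delta}\|_\infty=\max_{\substack{1\le k\le N_x\\N_1-m_1m_2\le d\le N_1-1}}s_d^{\mathrm{row}}(k),$$ where the absolute column sums (of the first CF-interval on level $1$) and the absolute row sums (of the last FC-interval on level $1$) are as follows. Abbreviate, for fixed $k$, $\lambda_\ell=\lambda_{\ell,k}$, $\alpha_1=|\lambda_1-\lambda_0^{m_0}|$, $\alpha_2=|\lambda_2-\lambda_0^{m_0}\lambda_1^{m_1-1}|$, $\alpha_3=|\lambda_3-\lambda_0^{m_0}\lambda_1^{m_1-1}\lambda_2^{m_2-1}|$, and $g_\ell(n)=\frac{1-|\lambda_\ell|^n}{1-|\lambda_\ell|}$ (so $g_\ell(n)=\sum_{q=0}^{n-1}|\lambda_\ell|^q$ for integers $n\ge0$). Column sums: $$s_0^{\mathrm{col}}=|\lambda_3|^{N_3-2}\alpha_3+\alpha_3\,g_3(N_3-2)g_2(m_2)g_1(m_1)+\alpha_2\,g_2(m_2-1)g_1(m_1)+\alpha_1\,g_1(m_1-1);$$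 for $j=1,\dots,m_2-1$, $$s_{m_1(m_2-j)}^{\mathrm{col}}=\alpha_2\,g_2(j-1)g_1(m_1)+\alpha_1\,g_1(m_1-1)+|\lambda_2|^{j-1}\alpha_2\big[|\lambda_3|^{N_3-2}+g_3(N_3-2)g_2(m_2)g_1(m_1-1)\big];$$ for $j=0,\dots,m_2-1$ and $r=0,\dots,m_1-2$, $$s_{m_1(m_2-j)-r-1}^{\mathrm{col}}=\alpha_1\big[g_1(m_1)g_2(j)+g_1(r)\big]+|\lambda_2|^j|\lambda_1|^r\alpha_1\big[|\lambda_3|^{N_3-2}+g_3(N_3-2)g_2(m_2)g_1(m_1)\big].$$ Row sums: $$s_{N_1-1}^{\mathrm{row}}=g_3(N_3-1)\big[\alpha_1g_2(m_2)g_1(m_1-1)+\alpha_2g_2(m_2-1)+\alpha_3\big];$$ for $j=1,\dots,m_2-1$, $$s_{N_1-1-m_1m_2+jm_1}^{\mathrm{row}}=g_2(j)\big[\alpha_1g_1(m_1-1)+\alpha_2\big]+|\lambda_2|^jg_3(N_3-2)\big[\alpha_1g_2(m_2)g_1(m_1-1)+\alpha_2g_2(m_2-1)+\alpha_3\big];$$ for $j=0,\dots,m_2-1$ and $r=1,\dots,m_1-1$, $$\begin{aligned}s_{N_1-1-m_1m_2+r+jm_1}^{\mathrm{row}}=\;&|\lambda_1|^r|\lambda_2|^jg_3(N_3-2)\big[\alpha_2g_2(m_2-1)+\alpha_3\big]+|\lambda_1|^rg_2(j)\big[\alpha_2+\alpha_1g_1(m_1-1)\big]\\&+|\lambda_1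|^r\alpha_1g_3(N_3-2)g_2(m_2)g_1(m_1-1)+\alpha_1g_1(r).\end{aligned}$$
   Context: Fix $N_x\ge1$, coarsening factors $m_0,m_1,m_2\in\mathbb{N}$, and $N_0$ such that $N_\ell=(N_{\ell-1}-1)/m_{\ell-1}+1$, $\ell=1,2,3$, are integers. The time-stepping operators on levels $0,\dots,3$ are $N_x\times N_x$ matrices; below, $\Phi_\ell$ denotes the (unitarily) diagonalized operator $\mathrm{diag}(\lambda_{\ell,1},\dots,\lambda_{\ell,N_x})$, eigenvalues being ordered according to common eigenvectors, and all operators below and their norms are formed with these diagonal $\Phi_\ell$. Vectors on level $\ell$ consist of $N_\ell$ blocks of size $N_x$, indexed $0,\dots,N_\ell-1$. $\|\cdot\|_1$ and $\|\cdot\|_\infty$ are the maximum absolute column and row sum norms. - $A_\ell$ ($N_\ell\times N_\ell$ blocks) is block lower bidiagonal with $I$ on the block diagonal and $-\Phi_\ell$ on the first block subdiagonal. - $R_\ell$, $\ell=0,1,2$ ($N_{\ell+1}\times N_\ell$ blocks): block row $0$ has $I$ in block column $0$; block row $j\ge1$ has $\Phi_\ell^{m_\ell-i}$ in block column $(j-1)m_\ell+i$, $i=1,\dots,m_\ell$; zeros elsewhere. - $P_\ell$, $\ell=0,1,2$ ($N_\ell\times N_{\ell+1}$ blocks): block column $j$ has $\Phi_\ell^i$ in block row $jm_\ell+i$ for $0\le i\le m_\ell-1$, $jm_\ell+i\le N_\ell-1$; zeros elsewhere. - $R_{I_0}$ ($N_1\times N_0$ blocks): block row $j$ has $I$ in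 block column $jm_0$, zeros elsewhere. - $S_\ell$, $\ell=1,2$: the block columns of the identity on level $\ell$ whose block index is not a multiple of $m_\ell$ (F-points). The four-level V-cycle with F-relaxation has error propagator $\mathcal{E}_F^{n_\ell=4}=P_0\,\mathcal{E}_F^{n_\ell=4,\Delta}R_{I_0}$, where the level-$1$ error propagator is $$\mathcal{E}_F^{n_\ell=4,\Delta}=R_{I_0}\mathcal{E}_F^{n_\ell=4}P_0=I-\big[P_1P_2A_3^{-1}R_2R_1+S_1(S_1^TA_1S_1)^{-1}S_1^T+P_1S_2(S_2^TA_2S_2)^{-1}S_2^TR_1\big]R_0A_0P_0.$$ The errors satisfy $\mathbf e_{i+1}=\mathcal{E}_F^{n_\ell=4}\mathbf e_i$, $i\in\mathbb{N}_0$, and $\mathbf r_i=A_0\mathbf e_i$ is the fine-grid residual (up to sign) at iteration $i$. The worst-case convergence factor is $c_f=\max_i\|\mathbf r_{i+1}\|_2/\|\mathbf r_i\|_2$.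
   Formalization: Corrected: second column formula ends in g_1(m_1), not g_1(m_1-1); third has |λ_1|^r g_1(m_1)g_2(j); third row formula gains |λ_2|^j in its α_1 g_3 g_2 g_1 term. c_f counts i=0 only if the initial residual vanishes at F-points. N_3≥2 is assumed. *)

theory Defs
  imports
    "Jordan_Normal_Form.Gauss_Jordan_Elimination"
    "Jordan_Normal_Form.Schur_Decomposition"
    "HOL-Library.Extended_Real"
begin

text \<open>
  Parameters used throughout: \<open>Nx\<close> is the block size, \<open>m l\<close> the coarsening factor and
  \<open>N l\<close> the number of time points of level \<open>l\<close>, and \<open>\<Phi> l\<close> the \<open>Nx\<times>Nx\<close> time-stepping
  matrix of level \<open>l\<close>.
\<close>

text \<open>Entry \<open>k\<close> of block \<open>i\<close> has the flat index \<open>i * Nx + k\<close>, all indices starting at 0.\<close>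

definition block_mat :: "nat \<Rightarrow> nat \<Rightarrow> nat \<Rightarrow> (nat \<Rightarrow> nat \<Rightarrow> complex mat) \<Rightarrow> complex mat" where
  "block_mat Nx nr nc B =
     mat (nr * Nx) (nc * Nx) (\<lambda>(r, c). B (r div Nx) (c div Nx) $$ (r mod Nx, c mod Nx))"

definition A_op :: "nat \<Rightarrow> (nat \<Rightarrow> nat) \<Rightarrow> (nat \<Rightarrow> complex mat) \<Rightarrow> nat \<Rightarrow> complex mat" where
  "A_op Nx N \<Phi> l = block_mat Nx (N l) (N l) (\<lambda>i j.
     if i = j then 1\<^sub>m Nx else if i = j + 1 then - \<Phi> l else 0\<^sub>m Nx Nx)"

text \<open>Block column \<open>c = (j - 1) * m l + i\<close> with \<open>1 \<le> i \<le> m l\<close> has \<open>m l - i = j * m l - c\<close>.\<close>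

definition R_op ::
  "nat \<Rightarrow> (nat \<Rightarrow> nat) \<Rightarrow> (nat \<Rightarrow> nat) \<Rightarrow> (nat \<Rightarrow> complex mat) \<Rightarrow> nat \<Rightarrow> complex mat" where
  "R_op Nx m N \<Phi> l = block_mat Nx (N (Suc l)) (N l) (\<lambda>j c.
     if j = 0 then (if c = 0 then 1\<^sub>m Nx else 0\<^sub>m Nx Nx)
     else if (j - 1) * m l < c \<and> c \<le> j * m l then \<Phi> l ^\<^sub>m (j * m l - c)
     else 0\<^sub>m Nx Nx)"

definition P_op ::
  "nat \<Rightarrow> (nat \<Rightarrow> nat) \<Rightarrow> (nat \<Rightarrow> nat) \<Rightarrow> (nat \<Rightarrow> complex mat) \<Rightarrow> nat \<Rightarrow> complex mat" where
  "P_op Nx m N \<Phi> l = block_mat Nx (N l) (N (Suc l)) (\<lambda>r j.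
     if j * m l \<le> r \<and> r < j * m l + m l then \<Phi> l ^\<^sub>m (r - j * m l) else 0\<^sub>m Nx Nx)"

definition RI0_op :: "nat \<Rightarrow> (nat \<Rightarrow> nat) \<Rightarrow> (nat \<Rightarrow> nat) \<Rightarrow> complex mat" where
  "RI0_op Nx m N = block_mat Nx (N 1) (N 0) (\<lambda>j c. if c = j * m 0 then 1\<^sub>m Nx else 0\<^sub>m Nx Nx)"

definition F_points :: "(nat \<Rightarrow> nat) \<Rightarrow> (nat \<Rightarrow> nat) \<Rightarrow> nat \<Rightarrow> nat list" where
  "F_points m N l = filter (\<lambda>i. \<not> m l dvd i) [0..<N l]"

definition S_op :: "nat \<Rightarrow> (nat \<Rightarrow> nat) \<Rightarrow> (nat \<Rightarrow> nat) \<Rightarrow> nat \<Rightarrow> complex mat" where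
  "S_op Nx m N l = block_mat Nx (N l) (length (F_points m N l))
     (\<lambda>i c. if i = F_points m N l ! c then 1\<^sub>m Nx else 0\<^sub>m Nx Nx)"

text \<open>Only used for the (unit lower triangular) matrices \<open>A\<close> and \<open>S\<^sup>T A S\<close>.\<close>

definition minv :: "complex mat \<Rightarrow> complex mat" where
  "minv A = the (mat_inverse A)"

definition F_relax ::
  "nat \<Rightarrow> (nat \<Rightarrow> nat) \<Rightarrow> (nat \<Rightarrow> nat) \<Rightarrow> (nat \<Rightarrow> complex mat) \<Rightarrow> nat \<Rightarrow> complex mat" where
  "F_relax Nx m N \<Phi> l = S_op Nx m N l *
     minv (transpose_mat (S_op Nx m N l) * A_op Nx N \<Phi> l * S_op Nx m N l) *
     transpose_mat (S_op Nx m N l)"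

definition E_coarse ::
  "nat \<Rightarrow> (nat \<Rightarrow> nat) \<Rightarrow> (nat \<Rightarrow> nat) \<Rightarrow> (nat \<Rightarrow> complex mat) \<Rightarrow> complex mat" where
  "E_coarse Nx m N \<Phi> = 1\<^sub>m (N 1 * Nx) -
     (P_op Nx m N \<Phi> 1 * P_op Nx m N \<Phi> 2 * minv (A_op Nx N \<Phi> 3) *
        R_op Nx m N \<Phi> 2 * R_op Nx m N \<Phi> 1
      + F_relax Nx m N \<Phi> 1
      + P_op Nx m N \<Phi> 1 * F_relax Nx m N \<Phi> 2 * R_op Nx m N \<Phi> 1) *
     (R_op Nx m N \<Phi> 0 * A_op Nx N \<Phi> 0 * P_op Nx m N \<Phi> 0)"

definition E_fine ::
  "nat \<Rightarrow> (nat \<Rightarrow> nat) \<Rightarrow> (nat \<Rightarrow> nat) \<Rightarrow> (nat \<Rightarrow> complex mat) \<Rightarrow> complex mat" where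
  "E_fine Nx m N \<Phi> = P_op Nx m N \<Phi> 0 * E_coarse Nx m N \<Phi> * RI0_op Nx m N"

definition col_abs_sum :: "complex mat \<Rightarrow> nat \<Rightarrow> real" where
  "col_abs_sum M c = (\<Sum>r<dim_row M. cmod (M $$ (r, c)))"

definition row_abs_sum :: "complex mat \<Rightarrow> nat \<Rightarrow> real" where
  "row_abs_sum M r = (\<Sum>c<dim_col M. cmod (M $$ (r, c)))"

definition norm_1 :: "complex mat \<Rightarrow> real" where
  "norm_1 M = (MAX c\<in>{..<dim_col M}. col_abs_sum M c)"

definition norm_inf :: "complex mat \<Rightarrow> real" where
  "norm_inf M = (MAX r\<in>{..<dim_row M}. row_abs_sum M r)"

definition norm_2 :: "complex vec \<Rightarrow> real" where
  "norm_2 v = sqrt (\<Sum>i<dim_vec v. (cmod (v $ i))\<^sup>2)"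

text \<open>Absolute column and row sums belonging to time point \<open>d\<close> and spatial mode \<open>k\<close>.\<close>

definition s_col :: "nat \<Rightarrow> complex mat \<Rightarrow> nat \<Rightarrow> nat \<Rightarrow> real" where
  "s_col Nx M d k = col_abs_sum M (d * Nx + k)"

definition s_row :: "nat \<Rightarrow> complex mat \<Rightarrow> nat \<Rightarrow> nat \<Rightarrow> real" where
  "s_row Nx M d k = row_abs_sum M (d * Nx + k)"

definition err ::
  "nat \<Rightarrow> (nat \<Rightarrow> nat) \<Rightarrow> (nat \<Rightarrow> nat) \<Rightarrow> (nat \<Rightarrow> complex mat) \<Rightarrow> complex vec \<Rightarrow> nat \<Rightarrow> complex vec"
  where
  "err Nx m N \<Phi> e0 i = ((\<lambda>e. E_fine Nx m N \<Phi> *\<^sub>v e) ^^ i) e0"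

definition res ::
  "nat \<Rightarrow> (nat \<Rightarrow> nat) \<Rightarrow> (nat \<Rightarrow> nat) \<Rightarrow> (nat \<Rightarrow> complex mat) \<Rightarrow> complex vec \<Rightarrow> nat \<Rightarrow> complex vec"
  where
  "res Nx m N \<Phi> e0 i = A_op Nx N \<Phi> 0 *\<^sub>v err Nx m N \<Phi> e0 i"

text \<open>
  \<open>P\<^sub>0 R\<^sub>I\<^sub>0\<close> is the error propagator of F-relaxation on the fine level, so this says that the
  residual of \<open>e\<close> vanishes at the F-points.
\<close>

definition F_relaxed ::
  "nat \<Rightarrow> (nat \<Rightarrow> nat) \<Rightarrow> (nat \<Rightarrow> nat) \<Rightarrow> (nat \<Rightarrow> complex mat) \<Rightarrow> complex vec \<Rightarrow> bool" where
  "F_relaxed Nx m N \<Phi> e \<longleftrightarrow> P_op Nx m N \<Phi> 0 *\<^sub>v (RI0_op Nx m N *\<^sub>v e) = e"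

text \<open>
  The convergence factor of the iteration started at \<open>e0\<close>. Every iterate with \<open>i \<ge> 1\<close> is
  F-relaxed. The step \<open>i = 0\<close> counts only if the initial error is F-relaxed as well: from an
  arbitrary \<open>e0\<close> it also contains the norm of \<open>R_op Nx m N \<Phi> 0\<close>, which may exceed 1 and does
  not enter the level-1 propagator \<open>E_coarse\<close>.
  The supremum is a maximum, since \<open>E_coarse\<close> is nilpotent; once the residual is zero it stays
  zero, and the quotient 0/0 = 0 does not contribute. Taking it in the extended reals
  avoids any junk value for unbounded sets.
\<close>

definition conv_factor ::
  "nat \<Rightarrow> (nat \<Rightarrow> nat) \<Rightarrow> (nat \<Rightarrow> nat) \<Rightarrow> (nat \<Rightarrow> complex mat) \<Rightarrow> complex vec \<Rightarrow> ereal" where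
  "conv_factor Nx m N \<Phi> e0 = (SUP i\<in>{i. i \<ge> 1 \<or> F_relaxed Nx m N \<Phi> e0}.
     ereal (norm_2 (res Nx m N \<Phi> e0 (Suc i)) / norm_2 (res Nx m N \<Phi> e0 i)))"

text \<open>\<open>lam l k\<close> is the \<open>k\<close>-th eigenvalue on level \<open>l\<close>, for \<open>k < Nx\<close>.\<close>

definition \<alpha>\<^sub>1 :: "(nat \<Rightarrow> nat) \<Rightarrow> (nat \<Rightarrow> nat \<Rightarrow> complex) \<Rightarrow> nat \<Rightarrow> real" where
  "\<alpha>\<^sub>1 m lam k = cmod (lam 1 k - lam 0 k ^ m 0)"

definition \<alpha>\<^sub>2 :: "(nat \<Rightarrow> nat) \<Rightarrow> (nat \<Rightarrow> nat \<Rightarrow> complex) \<Rightarrow> nat \<Rightarrow> real" where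
  "\<alpha>\<^sub>2 m lam k = cmod (lam 2 k - lam 0 k ^ m 0 * lam 1 k ^ (m 1 - 1))"

definition \<alpha>\<^sub>3 :: "(nat \<Rightarrow> nat) \<Rightarrow> (nat \<Rightarrow> nat \<Rightarrow> complex) \<Rightarrow> nat \<Rightarrow> real" where
  "\<alpha>\<^sub>3 m lam k = cmod (lam 3 k - lam 0 k ^ m 0 * lam 1 k ^ (m 1 - 1) * lam 2 k ^ (m 2 - 1))"

definition geo :: "(nat \<Rightarrow> nat \<Rightarrow> complex) \<Rightarrow> nat \<Rightarrow> nat \<Rightarrow> nat \<Rightarrow> real" where
  "geo lam k l n = (1 - cmod (lam l k) ^ n) / (1 - cmod (lam l k))"

end

theory Submission
  imports Defs "HOL-Analysis.Convex"
begin

text \<open>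
  All operators act on each spatial mode separately, so every block matrix is determined by one
  scalar matrix per mode. For a fixed mode, the V-cycle approximate inverse \<open>X\<close> of a level has the
  following entry at \<open>(i, j)\<close>: walk from \<open>j\<close> up to the next C-point with powers of \<open>\<lambda>\<close>, use the
  approximate inverse of the coarser level between C-points, and walk on from the last C-point
  to \<open>i\<close>; if there is no C-point between \<open>j\<close> and \<open>i\<close>, the entry is \<open>\<lambda> ^ (i - j)\<close>.
  If the operator that \<open>X\<close> is meant to invert has unit diagonal and subdiagonal \<open>- a\<close>, then the error
  propagator has below the diagonal the entries \<open>a * X i (j + 1) - X i j\<close>. If \<open>j\<close> is an F-point, this
  is \<open>(a - \<lambda>) * X i (j + 1)\<close>; if \<open>j\<close> is a C-point and \<open>i\<close> lies in a later interval, it is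
  \<open>\<lambda> ^ (i mod m)\<close> times the corresponding entry of the next level with \<open>a * \<lambda> ^ (m - 1)\<close> in place
  of \<open>a\<close>. Summing over an interval turns this into a recursion over the levels for the absolute
  column and row sums; the sums are monotone under a shift by \<open>m\<^sub>1 m\<^sub>2\<close>, so the first (last)
  coarsest interval attains the maximum.

  For the convergence factor, let \<open>A\<close> be the bidiagonal matrix \<open>R\<^sub>0 A\<^sub>0 P\<^sub>0\<close>. Residuals at C-points are
  propagated by \<open>A E A\<^sup>-\<^sup>1 = I - A X\<close>, where \<open>E = I - X A\<close>. Both \<open>A\<close> and \<open>X\<close> are symmetric about the antidiagonal,
  hence \<open>I - A X\<close> is \<open>E\<close> reflected there, and the Schur test bounds its 2-norm by
  \<open>sqrt (norm_1 E * norm_inf E)\<close>.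
\<close>

section \<open>Approximate inverses of a single mode\<close>

text \<open>For \<open>1 \<le> m\<close> this is the ceiling of \<open>j / m\<close>: the coarse
  index of the first C-point at or after \<open>j\<close>, which is where restriction sends column
  \<open>j\<close>.\<close>

definition cdiv :: "nat \<Rightarrow> nat \<Rightarrow> nat" where
  "cdiv j m = (j + m - 1) div m"

text \<open>
  One level of the V-cycle: F-relaxation plus \<open>P X R\<close>, for an approximate inverse \<open>X\<close> of the coarser
  level. The first branch applies if a C-point lies in \<open>{j..i}\<close>.
\<close>

definition cyc_inv :: "nat \<Rightarrow> complex \<Rightarrow> (nat \<Rightarrow> nat \<Rightarrow> complex) \<Rightarrow> nat \<Rightarrow> nat \<Rightarrow> complex" where
  "cyc_inv m x X i j =
     (if j \<le> m * (i div m) then x ^ (i mod m) * X (i div m) (cdiv j m) * x ^ (m * cdiv j m - j)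
      else if j \<le> i then x ^ (i - j) else 0)"

text \<open>Sequential time stepping, the exact inverse of the bidiagonal operator; it serves as the
  solve on the coarsest level.\<close>

definition seq_inv :: "complex \<Rightarrow> nat \<Rightarrow> nat \<Rightarrow> complex" where
  "seq_inv x i j = (if j \<le> i then x ^ (i - j) else 0)"

text \<open>
  The matrix \<open>I - X A\<close> for a lower triangular \<open>X\<close> with unit diagonal and the lower bidiagonal \<open>A\<close> with
  unit diagonal and subdiagonal \<open>- a\<close>.
\<close>

definition err_prop :: "complex \<Rightarrow> (nat \<Rightarrow> nat \<Rightarrow> complex) \<Rightarrow> nat \<Rightarrow> nat \<Rightarrow> complex" where
  "err_prop a X i j = (if j < i then a * X i (Suc j) - X i j else 0)"

text \<open>Matrices of one mode are functions on all pairs of naturals, so no size is carried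
  through the recursion over the levels; triangularity removes the entries that would reach beyond
  the grid.\<close>

definition lower_tri :: "(nat \<Rightarrow> nat \<Rightarrow> complex) \<Rightarrow> bool" where
  "lower_tri X \<longleftrightarrow> (\<forall>i j. i < j \<longrightarrow> X i j = 0)"

definition unit_diag :: "(nat \<Rightarrow> nat \<Rightarrow> complex) \<Rightarrow> bool" where
  "unit_diag X \<longleftrightarrow> (\<forall>i. X i i = 1)"

section \<open>Geometric sums and sums grouped into blocks\<close>

definition gsum :: "real \<Rightarrow> nat \<Rightarrow> real" where
  "gsum x n = (\<Sum>q<n. x ^ q)"

lemma gsum_simps [simp]: "gsum x 0 = 0" "gsum x (Suc n) = gsum x n + x ^ n"
  by (simp_all add: gsum_def)

lemma gsum_nonneg: "0 \<le> x \<Longrightarrow> 0 \<le> gsum x n"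
  by (simp add: gsum_def sum_nonneg)

lemma gsum_ge_1: "0 \<le> x \<Longrightarrow> 1 \<le> n \<Longrightarrow> 1 \<le> gsum x n"
  by (induction n) (auto simp: gsum_nonneg le_Suc_eq add_increasing2)

lemma gsum_closed: "0 \<le> x \<Longrightarrow> x < 1 \<Longrightarrow> gsum x n = (1 - x ^ n) / (1 - x)"
  by (simp add: gsum_def sum_gp_strict)

lemma gsum_rev: "(\<Sum>s<n. x ^ (n - 1 - s)) = gsum x n"
  unfolding gsum_def by (subst sum.nat_diff_reindex[symmetric]) (auto intro!: sum.cong)

lemma gsum_shift: "(\<Sum>i\<in>{a..<b}. x ^ (i - a)) = gsum x (b - a)"
proof (cases "a \<le> b")
  case True
  have "(\<Sum>i\<in>{0 + a..<(b - a) + a}. x ^ (i - a)) = (\<Sum>i\<in>{0..<b - a}. x ^ (i + a - a))"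
    by (rule sum.shift_bounds_nat_ivl)
  with True show ?thesis by (simp add: gsum_def atLeast0LessThan)
qed simp

lemma sum_block: "(\<Sum>i<K * m. f i) = (\<Sum>q<K. \<Sum>s<m. f (m * q + s))" for f :: "nat \<Rightarrow> 'a::comm_monoid_add"
proof (induction K)
  case (Suc K)
  have "(\<Sum>i<Suc K * m. f i) = (\<Sum>i<K * m. f i) + (\<Sum>s<m. f (K * m + s))"
    using sum.nat_group[of f m "Suc K"] sum.nat_group[of f m K]
      sum.shift_bounds_nat_ivl[of f 0 "K * m" m]
    by (simp add: atLeast0LessThan add.commute)
  then show ?case using Suc by (simp add: mult.commute)
qed simp

section \<open>Rounding up to the next C-point\<close>

lemma cdiv_alt:
  assumes "1 \<le> m" "(J - 1) * m < j" "j \<le> J * m"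
  shows "cdiv j m = J"
proof -
  \<comment> \<open>For \<open>J = 0\<close> the truncated subtraction turns the hypotheses into
    \<open>0 < j\<close> and \<open>j \<le> 0\<close>, so this case is void.\<close>
  have "J \<ge> 1" using assms by (cases J) auto
  then have "(J - 1) * m + m = J * m" by (cases J) auto
  then have "J * m \<le> j + m - 1" "j + m - 1 < Suc J * m" using assms by auto
  then show ?thesis unfolding cdiv_def by (simp add: div_nat_eqI mult.commute)
qed

lemma cdiv_0 [simp]: "1 \<le> m \<Longrightarrow> cdiv 0 m = 0"
  by (simp add: cdiv_def)

lemma cdiv_mult [simp]: "1 \<le> m \<Longrightarrow> cdiv (m * c) m = c"
  by (cases c) (auto intro!: cdiv_alt simp: cdiv_0)

lemma cdiv_mult_add: "s < m \<Longrightarrow> cdiv (Suc (m * c + s)) m = Suc c"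
  by (intro cdiv_alt) (auto simp: mult.commute)

lemma not_dvdE:
  fixes j m :: nat
  assumes "\<not> m dvd j" "1 \<le> m"
  obtains c s where "j = Suc (m * c + s)" "Suc s < m" "c = j div m"
proof -
  have "j mod m \<noteq> 0" "j mod m < m" "m * (j div m) + j mod m = j"
    using assms by (auto simp: dvd_eq_mod_eq_0)
  then have "j = Suc (m * (j div m) + (j mod m - 1))" "Suc (j mod m - 1) < m" by linarith+
  then show thesis using that by blast
qed

lemma cdiv_not_dvd:
  assumes "\<not> m dvd j" "1 \<le> m"
  shows "cdiv j m = Suc (j div m)"
  using assms
proof (rule not_dvdE)
  fix c s
  assume "j = Suc (m * c + s)" "Suc s < m" "c = j div m"
  then show ?thesis using cdiv_mult_add[of s m c] by simp
qed

lemma le_mult_cdiv: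
  assumes "1 \<le> m"
  shows "j \<le> m * cdiv j m"
proof (cases "m dvd j")
  case True
  then show ?thesis using assms by (auto simp del: One_nat_def elim!: dvdE)
next
  case False
  have "j mod m < m" "m * (j div m) + j mod m = j" using assms by simp_all
  then show ?thesis unfolding cdiv_not_dvd[OF False assms] mult_Suc_right by linarith
qed

text \<open>Galois connection between rounding up and multiplication by \<open>m\<close>. It
  translates the case distinction of \<open>cyc_inv\<close> into a comparison of coarse
  indices.\<close>

lemma cdiv_le_iff:
  assumes "1 \<le> m"
  shows "cdiv j m \<le> q \<longleftrightarrow> j \<le> m * q"
proof
  assume "cdiv j m \<le> q"
  then show "j \<le> m * q" using le_mult_cdiv[OF assms, of j] mult_le_mono2[of "cdiv j m" q m] by linarith
next
  assume "j \<le> m * q"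
  then have "j + m - 1 < Suc q * m" using assms by (simp add: mult.commute)
  then show "cdiv j m \<le> q" unfolding cdiv_def using less_mult_imp_div_less by (metis less_Suc_eq_le)
qed

text \<open>Makes the distance to the next C-point a legal remainder modulo \<open>m\<close>, as
  needed when a reflection exchanges it with \<open>i mod m\<close>.\<close>

lemma cdiv_gap:
  assumes "1 \<le> m"
  shows "m * cdiv j m - j < m"
proof (cases "m dvd j")
  case True
  then show ?thesis using assms by (auto simp del: One_nat_def elim!: dvdE)
next
  case False
  then have "j mod m \<noteq> 0" by (simp add: dvd_eq_mod_eq_0)
  moreover have "m * (j div m) + j mod m = j" by simp
  ultimately show ?thesis using assms unfolding cdiv_not_dvd[OF False assms] mult_Suc_right by linarith
qed

section \<open>Entries of the approximate inverse and of the error propagator\<close>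

lemma lower_tri_seq_inv: "lower_tri (seq_inv x)" and unit_diag_seq_inv: "unit_diag (seq_inv x)"
  by (auto simp: lower_tri_def unit_diag_def seq_inv_def)

lemma lower_tri_cyc_inv:
  assumes "1 \<le> m"
  shows "lower_tri (cyc_inv m x X)"
proof -
  have "cyc_inv m x X i j = 0" if "i < j" for i j
  proof -
    have "\<not> j \<le> m * (i div m)" using that times_div_less_eq_dividend[of m i] by linarith
    with that show ?thesis by (simp add: cyc_inv_def)
  qed
  then show ?thesis by (simp add: lower_tri_def)
qed

lemma unit_diag_cyc_inv:
  assumes "1 \<le> m" "unit_diag X"
  shows "unit_diag (cyc_inv m x X)"
proof -
  have "cyc_inv m x X i i = 1" for i
  proof (cases "m dvd i")
    case True
    then show ?thesis using assms by (auto simp: cyc_inv_def unit_diag_def elim!: dvdE)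
  next
    case False
    then have "m * (i div m) < i"
        using times_div_less_eq_dividend[of m i] by (metis dvd_triv_left order_le_less)
    then show ?thesis by (simp add: cyc_inv_def)
  qed
  then show ?thesis by (simp add: unit_diag_def)
qed

text \<open>The branches of \<open>cyc_inv\<close> may be added because one of the two terms always
  vanishes: with a C-point in between the indicator fails, and without one the coarse entry lies
  above the diagonal of \<open>X\<close>. A sum of terms can be summed over rows termwise.\<close>

lemma cmod_cyc_inv:
  assumes m: "1 \<le> m" and X: "lower_tri X"
  shows "cmod (cyc_inv m x X i j) =
    cmod x ^ (i mod m) * cmod (X (i div m) (cdiv j m)) * cmod x ^ (m * cdiv j m - j)
    + (if j \<le> i \<and> i < m * cdiv j m then cmod x ^ (i - j) else 0)"
proof (cases "j \<le> m * (i div m)")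
  case True
  then have "cdiv j m \<le> i div m" using cdiv_le_iff[OF m] by blast
  then have "m * cdiv j m \<le> i"
    by (metis le_trans mult_le_mono2 times_div_less_eq_dividend)
  then show ?thesis using True by (simp add: cyc_inv_def norm_mult norm_power)
next
  case False
  then have *: "i div m < cdiv j m" using cdiv_le_iff[OF m] by (metis not_le)
  then have "i < m * cdiv j m" using m
    by (simp add: div_less_iff_less_mult mult.commute)
  then show ?thesis using False X * by (simp add: cyc_inv_def lower_tri_def norm_power)
qed

text \<open>An F-point \<open>j\<close> and its successor have the same next C-point, so the entries
  in these two columns differ by one factor \<open>x\<close>.\<close>

lemma err_prop_cyc_F:
  assumes m: "1 \<le> m" and j: "\<not> m dvd j" "j < i"
  shows "err_prop a (cyc_inv m x X) i j = (a - x) * cyc_inv m x X i (Suc j)"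
proof -
  obtain c s where c: "j = Suc (m * c + s)" "Suc s < m" using j(1) m by (rule not_dvdE)
  have e: "cdiv j m = Suc c" "cdiv (Suc j) m = Suc c"
    using c cdiv_mult_add[of s m c] cdiv_mult_add[of "Suc s" m c] by auto
  have iff: "j \<le> m * (i div m) \<longleftrightarrow> Suc j \<le> m * (i div m)"
    using cdiv_le_iff[OF m] e by metis
  have "m * Suc c - j = Suc (m * Suc c - Suc j)" using c by simp
  then have p: "x ^ (m * Suc c - j) = x * x ^ (m * Suc c - Suc j)" by (simp only: power_Suc)
  have p2: "x ^ (i - j) = x * x ^ (i - Suc j)" using j by (metis Suc_diff_Suc power_Suc)
  show ?thesis using j
    unfolding err_prop_def cyc_inv_def iff e p p2 by (auto simp: algebra_simps)
qed

text \<open>Within the interval of \<open>i\<close> the entries are those of plain time stepping. If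
  \<open>j\<close> is the C-point opening the interval, the coarse factor is a diagonal entry of
  \<open>X\<close>, hence 1.\<close>

lemma err_prop_cyc_interval:
  assumes m: "1 \<le> m" and j: "m * (i div m) \<le> j" "j < i" and X: "unit_diag X"
  shows "err_prop a (cyc_inv m x X) i j = (a - x) * x ^ (i - Suc j)"
proof (cases "m dvd j")
  case False
  then show ?thesis using err_prop_cyc_F[OF m False j(2)] j by (auto simp: cyc_inv_def)
next
  case True
  then obtain c where c: "j = m * c" by blast
  have "c \<le> i div m" using j(2) c m by (simp add: less_eq_div_iff_mult_less_eq mult.commute)
  with j c m have jc: "c = i div m" by auto
  have "i = m * c + i mod m" using jc by simp
  then have im: "i mod m = i - j" using c by simp
  have p2: "x ^ (i - j) = x * x ^ (i - Suc j)" using j by (metis Suc_diff_Suc power_Suc)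
  have "cyc_inv m x X i j = x ^ (i - j)" using X c m jc im
    by (simp add: cyc_inv_def unit_diag_def)
  moreover have "cyc_inv m x X i (Suc j) = x ^ (i - Suc j)" using j by (auto simp: cyc_inv_def)
  ultimately show ?thesis using j p2 by (simp add: err_prop_def algebra_simps)
qed

text \<open>Column \<open>m * c\<close> enters the coarse level at \<open>c\<close>, whereas its
  right neighbour first travels \<open>m - 1\<close> steps to the C-point \<open>m * Suc c\<close>;
  these steps are absorbed into the new subdiagonal \<open>a * x ^ (m - 1)\<close>.\<close>

lemma err_prop_cyc_C:
  assumes m: "1 \<le> m" and c: "c < i div m"
  shows "err_prop a (cyc_inv m x X) i (m * c) = x ^ (i mod m) * err_prop (a * x ^ (m - 1)) X (i div m) c"
proof -
  have l: "m * Suc c \<le> m * (i div m)" using c by (intro mult_le_mono2) auto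
  have e: "cdiv (Suc (m * c)) m = Suc c" using cdiv_mult_add[of 0 m c] m by simp
  have "Suc (m * c) \<le> m * Suc c" using m by simp
  with l have "Suc (m * c) \<le> m * (i div m)" by linarith
  moreover have "m * (i div m) \<le> i" by simp
  moreover have "m * Suc c - Suc (m * c) = m - 1" by simp
  moreover have "m * c < i" "m * c \<le> m * (i div m)" "cdiv (m * c) m = c"
    using calculation m by (linarith, linarith, simp del: One_nat_def)
  ultimately show ?thesis using c e by (simp add: err_prop_def cyc_inv_def algebra_simps)
qed

lemma cmod_err_prop_cyc_F:
  assumes m: "1 \<le> m" and j: "\<not> m dvd j"
  shows "cmod (err_prop a (cyc_inv m x X) i j) = cmod (x - a) * cmod (cyc_inv m x X i (Suc j))"
proof (cases "j < i")
  case True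
  then show ?thesis using err_prop_cyc_F[OF m j True] by (simp add: norm_mult norm_minus_commute)
next
  case False
  then show ?thesis using lower_tri_cyc_inv[OF m, of x X] by (simp add: err_prop_def lower_tri_def)
qed

text \<open>The two summands live on disjoint sets of rows: the interval opened by the C-point, and
  all later intervals.\<close>

lemma cmod_err_prop_cyc_C:
  assumes m: "1 \<le> m" and X: "unit_diag X"
  shows "cmod (err_prop a (cyc_inv m x X) i (m * c)) =
    (if m * c < i \<and> i < m * Suc c then cmod (x - a) * cmod x ^ (i - Suc (m * c)) else 0)
    + cmod x ^ (i mod m) * cmod (err_prop (a * x ^ (m - 1)) X (i div m) c)"
proof (cases "c < i div m")
  case True
  then have "m * Suc c \<le> m * (i div m)" by (intro mult_le_mono2) auto
  also have "\<dots> \<le> i" by simp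
  finally show ?thesis using err_prop_cyc_C[OF m True] by (simp add: norm_mult norm_power)
next
  case False
  then have "i < m * Suc c" using m
    by (simp add: div_less_iff_less_mult not_less mult.commute flip: less_Suc_eq_le)
  moreover have "m * (i div m) \<le> m * c" using False by (intro mult_le_mono2) auto
  ultimately show ?thesis using False err_prop_cyc_interval[OF m _ _ X, of i "m * c" a x]
    by (auto simp: err_prop_def norm_mult norm_power norm_minus_commute)
qed


section \<open>Recursions over one level for column and row sums\<close>

text \<open>
  The last point is treated separately, since it starts an interval that contains no further point.
\<close>

definition col_init :: "nat \<Rightarrow> (nat \<Rightarrow> nat \<Rightarrow> complex) \<Rightarrow> nat \<Rightarrow> real" where
  "col_init K X j = (\<Sum>i<K. cmod (X i j))"

text \<open>The columns are shifted by one because an F-column \<open>j\<close> of the error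
  propagator carries the entry \<open>X i (Suc j)\<close>.\<close>

definition row_tail :: "(nat \<Rightarrow> nat \<Rightarrow> complex) \<Rightarrow> nat \<Rightarrow> real" where
  "row_tail X i = (\<Sum>j<i. cmod (X i (Suc j)))"

definition row_init :: "(nat \<Rightarrow> nat \<Rightarrow> complex) \<Rightarrow> nat \<Rightarrow> real" where
  "row_init X i = (\<Sum>j<i. cmod (X i j))"

lemma col_init_nonneg: "0 \<le> col_init K X j"
  by (simp add: col_init_def sum_nonneg)

lemma sum_shifted_powers:
  fixes x :: real
  assumes "b \<le> n"
  shows "(\<Sum>i<n. if a \<le> i \<and> i < b then x ^ (i - a) else 0) = gsum x (b - a)"
proof -
  have "(\<Sum>i<n. if a \<le> i \<and> i < b then x ^ (i - a) else 0) = (\<Sum>i\<in>{a..<b}. x ^ (i - a))"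
    using assms by (intro sum.mono_neutral_cong_right) auto
  then show ?thesis by (simp add: gsum_shift)
qed

lemma sum_block_weighted:
  fixes x :: real
  shows "(\<Sum>i<m * K. x ^ (i mod m) * f (i div m)) = gsum x m * (\<Sum>q<K. f q)"
proof -
  have "(\<Sum>i<m * K. x ^ (i mod m) * f (i div m)) = (\<Sum>q<K. \<Sum>s<m. x ^ s * f q)"
    by (subst mult.commute, subst sum_block) (auto intro!: sum.cong)
  then show ?thesis by (simp add: gsum_def sum_distrib_left sum_distrib_right)
qed

text \<open>The rows from \<open>j\<close> up to the next C-point give the first geometric sum. From
  there on the rows form complete intervals, each a coarse entry times
  \<open>gsum (cmod x) m\<close>.\<close>

lemma col_init_cyc_inv:
  assumes m: "1 \<le> m" and X: "lower_tri X" and J: "cdiv j m \<le> K"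
  defines "t \<equiv> m * cdiv j m - j"
  shows "col_init (m * K) (cyc_inv m x X) j =
    gsum (cmod x) t + cmod x ^ t * (gsum (cmod x) m * col_init K X (cdiv j m))"
proof -
  have "col_init (m * K) (cyc_inv m x X) j =
      (\<Sum>i<m * K. cmod x ^ (i mod m) * cmod (X (i div m) (cdiv j m))) * cmod x ^ t
      + (\<Sum>i<m * K. if j \<le> i \<and> i < m * cdiv j m then cmod x ^ (i - j) else 0)"
    unfolding col_init_def cmod_cyc_inv[OF m X] sum.distrib t_def sum_distrib_right ..
  then show ?thesis
    unfolding sum_block_weighted[where f = "\<lambda>q. cmod (X q (cdiv j m))"]
      sum_shifted_powers[OF mult_le_mono2[OF J]]
    by (simp add: t_def col_init_def)
qed

lemma last_cyc_inv:
  assumes m: "1 \<le> m" and X: "lower_tri X" and J: "cdiv j m \<le> K"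
  shows "cmod (cyc_inv m x X (m * K) j) =
    cmod x ^ (m * cdiv j m - j) * cmod (X K (cdiv j m))"
proof -
  have "m * cdiv j m \<le> m * K" using J by simp
  then show ?thesis unfolding cmod_cyc_inv[OF m X] using m by simp
qed

lemma col_init_err_F:
  assumes "1 \<le> m" "\<not> m dvd j"
  shows "col_init n (err_prop a (cyc_inv m x X)) j =
    cmod (x - a) * col_init n (cyc_inv m x X) (Suc j)"
  unfolding col_init_def cmod_err_prop_cyc_F[OF assms] sum_distrib_left ..

lemma col_init_err_C:
  assumes m: "1 \<le> m" and X: "unit_diag X" and c: "c < K"
  shows "col_init (m * K) (err_prop a (cyc_inv m x X)) (m * c) =
    cmod (x - a) * gsum (cmod x) (m - 1)
    + gsum (cmod x) m * col_init K (err_prop (a * x ^ (m - 1)) X) c"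
proof -
  have "m * Suc c \<le> m * K" using c by (intro mult_le_mono2) auto
  moreover have "(\<Sum>i<m * K. if m * c < i \<and> i < m * Suc c
        then cmod (x - a) * cmod x ^ (i - Suc (m * c)) else 0)
      = cmod (x - a) * (\<Sum>i<m * K. if Suc (m * c) \<le> i \<and> i < m * Suc c
        then cmod x ^ (i - Suc (m * c)) else 0)"
    unfolding sum_distrib_left by (intro sum.cong) (auto simp: Suc_le_eq)
  moreover have "m * Suc c - Suc (m * c) = m - 1" by simp
  ultimately show ?thesis
    unfolding col_init_def cmod_err_prop_cyc_C[OF m X] sum.distrib
      sum_block_weighted[where f = "\<lambda>q. cmod (err_prop (a * x ^ (m - 1)) X q c)"]
    by (simp only: sum_shifted_powers)
qed

lemma last_err_C:
  assumes m: "1 \<le> m" and X: "unit_diag X" and c: "c < K"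
  shows "cmod (err_prop a (cyc_inv m x X) (m * K) (m * c)) =
    cmod (err_prop (a * x ^ (m - 1)) X K c)"
proof -
  have "m * Suc c \<le> m * K" using c by (intro mult_le_mono2) auto
  then have "\<not> m * K < m * Suc c" by linarith
  then show ?thesis unfolding cmod_err_prop_cyc_C[OF m X] using m by simp
qed

lemma col_init_seq_inv: "col_init K (seq_inv x) j = gsum (cmod x) (K - j)"
proof -
  have "col_init K (seq_inv x) j = (\<Sum>i<K. if j \<le> i \<and> i < K then cmod x ^ (i - j) else 0)"
    unfolding col_init_def by (intro sum.cong) (auto simp: seq_inv_def norm_power)
  then show ?thesis by (simp only: sum_shifted_powers[OF order_refl])
qed

lemma cmod_err_seq_inv:
  "cmod (err_prop a (seq_inv x) i j) = (if j < i then cmod (x - a) * cmod x ^ (i - Suc j) else 0)"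
proof (cases "j < i")
  case True
  then have "x ^ (i - j) = x * x ^ (i - Suc j)" by (metis Suc_diff_Suc power_Suc)
  then have "err_prop a (seq_inv x) i j = (a - x) * x ^ (i - Suc j)"
    using True by (simp add: err_prop_def seq_inv_def algebra_simps)
  then show ?thesis using True by (simp add: norm_mult norm_power norm_minus_commute)
qed (simp add: err_prop_def)

lemma col_init_err_seq_inv:
  "col_init K (err_prop a (seq_inv x)) j = cmod (x - a) * gsum (cmod x) (K - Suc j)"
proof -
  have "col_init K (err_prop a (seq_inv x)) j =
      cmod (x - a) * (\<Sum>i<K. if Suc j \<le> i \<and> i < K then cmod x ^ (i - Suc j) else 0)"
    unfolding col_init_def sum_distrib_left
    by (intro sum.cong) (auto simp: cmod_err_seq_inv)
  then show ?thesis by (simp only: sum_shifted_powers[OF order_refl])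
qed

lemma sum_split_interval:
  fixes f :: "nat \<Rightarrow> 'a::comm_monoid_add"
  shows "(\<Sum>j<i. f j) = (\<Sum>c<i div m. \<Sum>s<m. f (m * c + s)) + (\<Sum>s<i mod m. f (m * (i div m) + s))"
proof -
  have "(\<Sum>j<i. f j) = (\<Sum>j<m * (i div m) + i mod m. f j)" by simp
  also have "\<dots> = (\<Sum>j<i div m * m. f j) + (\<Sum>s<i mod m. f (m * (i div m) + s))"
    using sum.nat_group[of f 1] sum.atLeastLessThan_concat[of 0 "m * (i div m)" "m * (i div m) + i mod m" f]
      sum.shift_bounds_nat_ivl[of f 0 "m * (i div m)" "i mod m"]
    by (simp add: atLeast0LessThan add.commute mult.commute)
  finally show ?thesis by (simp add: sum_block)
qed

text \<open>Columns are grouped by interval. Because of the shift by one,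
  \<open>Suc (m * c + s)\<close> with \<open>s < m\<close> runs over exactly the columns whose next
  C-point has index \<open>Suc c\<close>, so each complete interval yields a full geometric
  sum.\<close>

lemma row_tail_cyc_inv:
  assumes m: "1 \<le> m"
  shows "row_tail (cyc_inv m x X) i = gsum (cmod x) (i mod m)
    + cmod x ^ (i mod m) * (gsum (cmod x) m * row_tail X (i div m))"
proof -
  let ?q = "i div m" and ?t = "i mod m"
  have 1: "cmod (cyc_inv m x X i (Suc (m * c + s))) =
      cmod x ^ ?t * cmod (X ?q (Suc c)) * cmod x ^ (m - 1 - s)" if "c < ?q" "s < m" for c s
  proof -
    have "m * Suc c \<le> m * ?q" using that by (intro mult_le_mono2) auto
    moreover have "m * Suc c - Suc (m * c + s) = m - 1 - s" by simp
    ultimately show ?thesis using that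
      by (simp add: cyc_inv_def cdiv_mult_add norm_mult norm_power)
  qed
  have 2: "cmod (cyc_inv m x X i (Suc (m * ?q + s))) = cmod x ^ (?t - 1 - s)" if "s < ?t" for s
  proof -
    have "Suc (m * ?q + s) \<le> m * ?q + ?t" using that by linarith
    then have "Suc (m * ?q + s) \<le> i" by (simp only: mult_div_mod_eq)
    moreover have "i - Suc (m * ?q + s) = ?t - 1 - s"
      using mult_div_mod_eq[of m i] by linarith
    ultimately show ?thesis by (simp add: cyc_inv_def norm_power)
  qed
  have "row_tail (cyc_inv m x X) i =
      (\<Sum>c<?q. \<Sum>s<m. cmod x ^ ?t * cmod (X ?q (Suc c)) * cmod x ^ (m - 1 - s))
      + (\<Sum>s<?t. cmod x ^ (?t - 1 - s))"
    unfolding row_tail_def sum_split_interval[of "\<lambda>j. cmod (cyc_inv m x X i (Suc j))" i m]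
    by (intro arg_cong2[where f = "(+)"] sum.cong refl 1 2) auto
  then show ?thesis
    unfolding gsum_rev sum_distrib_left[symmetric] sum_distrib_right[symmetric]
    by (simp add: row_tail_def algebra_simps)
qed

text \<open>A complete interval has one C-column, which passes to the coarse error propagator, and
  \<open>m - 1\<close> F-columns, which carry entries of \<open>X\<close> and sum up to the coarse
  tail. The incomplete interval of \<open>i\<close> contributes plain powers.\<close>

lemma row_init_err_cyc_inv:
  assumes m: "1 \<le> m" and X: "unit_diag X"
  shows "row_init (err_prop a (cyc_inv m x X)) i =
    cmod (x - a) * gsum (cmod x) (i mod m)
    + cmod x ^ (i mod m) * (row_init (err_prop (a * x ^ (m - 1)) X) (i div m)
        + cmod (x - a) * gsum (cmod x) (m - 1) * row_tail X (i div m))"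
proof -
  let ?q = "i div m" and ?t = "i mod m"
  have 0: "cmod (err_prop a (cyc_inv m x X) i (m * c)) =
      cmod x ^ ?t * cmod (err_prop (a * x ^ (m - 1)) X ?q c)" if "c < ?q" for c
    using err_prop_cyc_C[OF m that] by (simp add: norm_mult norm_power)
  have 1: "cmod (err_prop a (cyc_inv m x X) i (m * c + Suc s)) =
      cmod (x - a) * (cmod x ^ ?t * cmod (X ?q (Suc c))) * cmod x ^ (m - 1 - 1 - s)"
    if "c < ?q" "s < m - 1" for c s
  proof -
    have "m * Suc c \<le> m * ?q" using that by (intro mult_le_mono2) auto
    then have "Suc (m * c + Suc s) \<le> m * ?q" using that by simp
    moreover have "m * Suc c - Suc (m * c + Suc s) = m - 1 - 1 - s" by simp
    moreover have "\<not> m dvd m * c + Suc s" using that nat_dvd_not_less[of "Suc s" m]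
      by (simp add: dvd_add_right_iff del: add_Suc_right)
    ultimately show ?thesis using that cdiv_mult_add[of "Suc s" m c]
      by (simp add: cmod_err_prop_cyc_F[OF m] cyc_inv_def norm_mult norm_power)
  qed
  have 2: "cmod (err_prop a (cyc_inv m x X) i (m * ?q + s)) = cmod (x - a) * cmod x ^ (?t - 1 - s)"
    if "s < ?t" for s
  proof -
    have "m * ?q + s < m * ?q + ?t" using that by linarith
    then have "m * ?q + s < i" by (simp only: mult_div_mod_eq)
    moreover have "i - Suc (m * ?q + s) = ?t - 1 - s"
      using mult_div_mod_eq[of m i] by linarith
    ultimately show ?thesis using err_prop_cyc_interval[OF m _ _ X, of i "m * ?q + s" a x]
      by (simp add: norm_mult norm_power norm_minus_commute)
  qed
  obtain m' where m': "m = Suc m'" using m by (cases m) auto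
  let ?E = "\<lambda>j. cmod (err_prop a (cyc_inv m x X) i j)"
  have "(\<Sum>s<m. ?E (m * c + s)) = cmod x ^ ?t * cmod (err_prop (a * x ^ (m - 1)) X ?q c)
      + (\<Sum>s<m - 1. cmod (x - a) * (cmod x ^ ?t * cmod (X ?q (Suc c))) * cmod x ^ (m - 1 - 1 - s))"
    if "c < ?q" for c
  proof -
    \<comment> \<open>Offset 0 is the C-column of the interval; all other offsets are
      F-columns.\<close>
    have "(\<Sum>s<m. ?E (m * c + s)) = ?E (m * c) + (\<Sum>s<m - 1. ?E (m * c + Suc s))"
      unfolding m' sum.lessThan_Suc_shift by simp
    also have "(\<Sum>s<m - 1. ?E (m * c + Suc s)) =
      (\<Sum>s<m - 1. cmod (x - a) * (cmod x ^ ?t * cmod (X ?q (Suc c))) * cmod x ^ (m - 1 - 1 - s))"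
      using 1[OF that] by (intro sum.cong) auto
    finally show ?thesis unfolding 0[OF that] .
  qed
  moreover have "(\<Sum>s<?t. ?E (m * ?q + s)) = (\<Sum>s<?t. cmod (x - a) * cmod x ^ (?t - 1 - s))"
    using 2 by (intro sum.cong) auto
  ultimately have "row_init (err_prop a (cyc_inv m x X)) i =
      (\<Sum>c<?q. cmod x ^ ?t * cmod (err_prop (a * x ^ (m - 1)) X ?q c)
        + (\<Sum>s<m - 1. cmod (x - a) * (cmod x ^ ?t * cmod (X ?q (Suc c))) * cmod x ^ (m - 1 - 1 - s)))
      + (\<Sum>s<?t. cmod (x - a) * cmod x ^ (?t - 1 - s))"
    unfolding row_init_def sum_split_interval[of ?E i m] by simp
  then show ?thesis
    unfolding sum.distrib sum_distrib_left[symmetric] sum_distrib_right[symmetric] gsum_rev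
    by (simp add: row_tail_def row_init_def algebra_simps)
qed

lemma row_tail_seq_inv: "row_tail (seq_inv x) i = gsum (cmod x) i"
proof -
  have "row_tail (seq_inv x) i = (\<Sum>s<i. cmod x ^ (i - 1 - s))"
    unfolding row_tail_def by (intro sum.cong) (auto simp: seq_inv_def norm_power)
  then show ?thesis by (simp only: gsum_rev)
qed

lemma row_init_err_seq_inv:
  "row_init (err_prop a (seq_inv x)) i = cmod (x - a) * gsum (cmod x) i"
proof -
  have "row_init (err_prop a (seq_inv x)) i = (\<Sum>s<i. cmod (x - a) * cmod x ^ (i - 1 - s))"
    unfolding row_init_def by (intro sum.cong) (auto simp: cmod_err_seq_inv)
  then show ?thesis by (simp only: gsum_rev sum_distrib_left[symmetric])
qed

section \<open>Column and row sums on three levels\<close>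

text \<open>Passing to the coarser level collapses each interval of rows into one row, whereas the
  last row stands alone; hence a common weight for all rows but the last.\<close>

definition col_weight :: "real \<Rightarrow> nat \<Rightarrow> (nat \<Rightarrow> nat \<Rightarrow> complex) \<Rightarrow> nat \<Rightarrow> real" where
  "col_weight w K X j = w * col_init K X j + cmod (X K j)"

lemma col_weight_1: "col_weight 1 K X j = (\<Sum>i\<le>K. cmod (X i j))"
  by (simp add: col_weight_def col_init_def lessThan_Suc_atMost[symmetric])

lemma col_weight_nonneg: "0 \<le> w \<Longrightarrow> 0 \<le> col_weight w K X j"
  by (simp add: col_weight_def col_init_nonneg)

lemma col_weight_seq_inv:
  "j \<le> K \<Longrightarrow> col_weight w K (seq_inv x) j = w * gsum (cmod x) (K - j) + cmod x ^ (K - j)"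
  by (simp add: col_weight_def col_init_seq_inv seq_inv_def norm_power)

lemma col_weight_err_seq_inv:
  "j < K \<Longrightarrow> col_weight w K (err_prop a (seq_inv x)) j =
    cmod (x - a) * (w * gsum (cmod x) (K - Suc j) + cmod x ^ (K - Suc j))"
  by (simp add: col_weight_def col_init_err_seq_inv cmod_err_seq_inv algebra_simps)

lemma col_weight_cyc_inv:
  assumes "1 \<le> m" "lower_tri X" "cdiv j m \<le> K"
  shows "col_weight w (m * K) (cyc_inv m x X) j =
    w * gsum (cmod x) (m * cdiv j m - j)
    + cmod x ^ (m * cdiv j m - j) * col_weight (w * gsum (cmod x) m) K X (cdiv j m)"
  unfolding col_weight_def col_init_cyc_inv[OF assms] last_cyc_inv[OF assms]
  by (simp add: algebra_simps)

lemma col_weight_err_F: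
  assumes "1 \<le> m" "\<not> m dvd j"
  shows "col_weight w n (err_prop a (cyc_inv m x X)) j =
    cmod (x - a) * col_weight w n (cyc_inv m x X) (Suc j)"
  unfolding col_weight_def col_init_err_F[OF assms] cmod_err_prop_cyc_F[OF assms]
  by (simp add: algebra_simps)

lemma col_weight_err_C:
  assumes "1 \<le> m" "unit_diag X" "c < K"
  shows "col_weight w (m * K) (err_prop a (cyc_inv m x X)) (m * c) =
    w * (cmod (x - a) * gsum (cmod x) (m - 1))
    + col_weight (w * gsum (cmod x) m) K (err_prop (a * x ^ (m - 1)) X) c"
  unfolding col_weight_def col_init_err_C[OF assms] last_err_C[OF assms]
  by (simp add: algebra_simps)

lemma col_weight_err_last: "K \<le> j \<Longrightarrow> col_weight w K (err_prop a X) j = 0"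
  by (simp add: col_weight_def col_init_def err_prop_def)

section \<open>Monotonicity of the column sums under a shift by one period\<close>

text \<open>
  The statement for all weights \<open>w \<ge> 1\<close> is what carries over to the finer level, where
  \<open>w\<close> turns into \<open>w * gsum (cmod x) m\<close>.
\<close>

definition cols_decrease :: "nat \<Rightarrow> nat \<Rightarrow> (nat \<Rightarrow> nat \<Rightarrow> complex) \<Rightarrow> bool" where
  "cols_decrease p K X \<longleftrightarrow>
     (\<forall>w\<ge>1. \<forall>j. j + p \<le> K \<longrightarrow> col_weight w K X (j + p) \<le> col_weight w K X j)"

text \<open>The difference of the two sides is \<open>(w - 1) * x ^ n + x ^ Suc n\<close>; this is
  where a weight of at least 1 enters.\<close>

lemma weighted_gsum_mono:
  assumes "0 \<le> x" "1 \<le> w"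
  shows "w * gsum x n + x ^ n \<le> w * gsum x (Suc n) + x ^ Suc n"
proof -
  have "1 * x ^ n \<le> w * x ^ n" using assms by (intro mult_right_mono) auto
  moreover have "0 \<le> x ^ Suc n" using assms by simp
  ultimately show ?thesis by (simp add: algebra_simps)
qed

lemma cols_decrease_seq_inv: "cols_decrease 1 K (seq_inv x)"
proof -
  have "col_weight w K (seq_inv x) (j + 1) \<le> col_weight w K (seq_inv x) j"
    if "1 \<le> w" "j + 1 \<le> K" for w j
  proof -
    have "K - j = Suc (K - (j + 1))" using that by simp
    then show ?thesis using that weighted_gsum_mono[of "cmod x" w "K - (j + 1)"]
      by (simp only: col_weight_seq_inv norm_ge_zero)
  qed
  then show ?thesis by (simp add: cols_decrease_def)
qed

lemma cols_decrease_err_seq_inv: "cols_decrease 1 K (err_prop a (seq_inv x))"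
proof -
  have "col_weight w K (err_prop a (seq_inv x)) (j + 1) \<le> col_weight w K (err_prop a (seq_inv x)) j"
    if w: "1 \<le> w" and j: "j + 1 \<le> K" for w j
  proof (cases "j + 1 = K")
    case True
    then show ?thesis using w by (simp add: col_weight_err_last col_weight_nonneg)
  next
    case False
    then have "K - Suc j = Suc (K - Suc (j + 1))" "j < K" "j + 1 < K" using j by simp_all
    then show ?thesis using mult_left_mono[OF weighted_gsum_mono[OF norm_ge_zero w] norm_ge_zero]
      by (simp only: col_weight_err_seq_inv)
  qed
  then show ?thesis by (simp add: cols_decrease_def)
qed

lemma cdiv_add_mult:
  assumes "1 \<le> m"
  shows "cdiv (j + m * p) m = cdiv j m + p"
proof -
  have e: "j + m * p + m - 1 = m * p + (j + m - 1)" using assms by simp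
  show ?thesis unfolding cdiv_def e using assms by (subst div_mult_self4) auto
qed

text \<open>Shifting the column by \<open>m * p\<close> moves the next C-point by \<open>p\<close>
  coarse indices and keeps the distance to it, so only the coarse column sum changes, with the
  weight \<open>w * gsum (cmod x) m\<close>, which is again at least 1.\<close>

lemma cols_decrease_cyc_inv:
  assumes m: "1 \<le> m" and X: "lower_tri X" and d: "cols_decrease p K X"
  shows "cols_decrease (m * p) (m * K) (cyc_inv m x X)"
proof -
  have "col_weight w (m * K) (cyc_inv m x X) (j + m * p) \<le> col_weight w (m * K) (cyc_inv m x X) j"
    if w: "1 \<le> w" and j: "j + m * p \<le> m * K" for w j
  proof -
    let ?t = "m * cdiv j m - j"
    have J: "cdiv (j + m * p) m = cdiv j m + p" by (rule cdiv_add_mult[OF m])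
    have JK: "cdiv j m + p \<le> K" using j cdiv_le_iff[OF m, of "j + m * p" K] J by simp
    have t: "m * (cdiv j m + p) - (j + m * p) = ?t" by (simp add: algebra_simps)
    have "1 * 1 \<le> w * gsum (cmod x) m" using w gsum_ge_1[OF norm_ge_zero m, of x]
      by (intro mult_mono) auto
    then have "col_weight (w * gsum (cmod x) m) K X (cdiv j m + p)
        \<le> col_weight (w * gsum (cmod x) m) K X (cdiv j m)"
      using d JK unfolding cols_decrease_def by simp
    then have "cmod x ^ ?t * col_weight (w * gsum (cmod x) m) K X (cdiv j m + p)
        \<le> cmod x ^ ?t * col_weight (w * gsum (cmod x) m) K X (cdiv j m)"
      by (intro mult_left_mono) auto
    moreover have "cdiv j m \<le> K" "cdiv (j + m * p) m \<le> K" using JK J by simp_all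
    ultimately show ?thesis by (simp add: col_weight_cyc_inv[OF m X] J t)
  qed
  then show ?thesis by (simp add: cols_decrease_def)
qed

text \<open>F-columns reduce to columns of the approximate inverse, C-columns to columns of the
  coarse error propagator; the shift preserves the kind of the column.\<close>

lemma cols_decrease_err_cyc_inv:
  assumes m: "1 \<le> m" and X: "lower_tri X" "unit_diag X" and d: "cols_decrease p K X"
    and de: "cols_decrease p K (err_prop (a * x ^ (m - 1)) X)"
  shows "cols_decrease (m * p) (m * K) (err_prop a (cyc_inv m x X))"
proof -
  let ?E = "err_prop a (cyc_inv m x X)"
  have "col_weight w (m * K) ?E (j + m * p) \<le> col_weight w (m * K) ?E j"
    if w: "1 \<le> w" and j: "j + m * p \<le> m * K" for w j
  proof (cases "j + m * p = m * K")
    \<comment> \<open>The last column of the error propagator vanishes. In all other cases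
      \<open>Suc j + m * p\<close>, respectively \<open>c + p\<close>, stays in the range where the
      reductions apply.\<close>
    case True
    then show ?thesis using w by (simp add: col_weight_err_last col_weight_nonneg)
  next
    case ne: False
    show ?thesis
    proof (cases "m dvd j")
      case False
      then have F: "\<not> m dvd j + m * p" by (simp add: dvd_add_left_iff)
      have "Suc j + m * p \<le> m * K" using j ne by simp
      then have "col_weight w (m * K) (cyc_inv m x X) (Suc j + m * p)
          \<le> col_weight w (m * K) (cyc_inv m x X) (Suc j)"
        using cols_decrease_cyc_inv[OF m X(1) d, of x] w unfolding cols_decrease_def by blast
      then show ?thesis
        unfolding col_weight_err_F[OF m F] col_weight_err_F[OF m False] add_Suc
        by (intro mult_left_mono) auto
    next
      case True
      then obtain c where c: "j = m * c" by blast
      have jc: "j + m * p = m * (c + p)" using c by (simp add: algebra_simps)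
      have "m * (c + p) < m * K" using j ne jc by linarith
      then have cK: "c + p < K" by simp
      have "1 * 1 \<le> w * gsum (cmod x) m" using w gsum_ge_1[OF norm_ge_zero m, of x]
        by (intro mult_mono) auto
      then have "col_weight (w * gsum (cmod x) m) K (err_prop (a * x ^ (m - 1)) X) (c + p)
          \<le> col_weight (w * gsum (cmod x) m) K (err_prop (a * x ^ (m - 1)) X) c"
        using de cK unfolding cols_decrease_def by simp
      moreover have "c < K" using cK by simp
      ultimately show ?thesis
        unfolding jc unfolding c by (simp add: col_weight_err_C[OF m X(2)] cK)
    qed
  qed
  then show ?thesis by (simp add: cols_decrease_def)
qed

section \<open>Monotonicity of the row sums under a shift by one period\<close>

lemma div_mod_add_mult:
  fixes m :: nat
  assumes "1 \<le> m"
  shows "(i + m * p) div m = i div m + p" "(i + m * p) mod m = i mod m"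
  using assms by auto

text \<open>The shift keeps the offset \<open>i mod m\<close>, so only the coarse tail changes, and
  it enters with a nonnegative factor.\<close>

lemma row_tail_cyc_inv_mono:
  assumes m: "1 \<le> m" and X: "\<And>i. row_tail X i \<le> row_tail X (i + p)"
  shows "row_tail (cyc_inv m x X) i \<le> row_tail (cyc_inv m x X) (i + m * p)"
  unfolding row_tail_cyc_inv[OF m] div_mod_add_mult[OF m]
  by (intro add_left_mono mult_left_mono X) (auto simp: gsum_nonneg)

lemma row_init_err_cyc_inv_mono:
  assumes m: "1 \<le> m" and X: "unit_diag X" "\<And>i. row_tail X i \<le> row_tail X (i + p)"
    and E: "\<And>i. row_init (err_prop (a * x ^ (m - 1)) X) i
      \<le> row_init (err_prop (a * x ^ (m - 1)) X) (i + p)"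
  shows "row_init (err_prop a (cyc_inv m x X)) i \<le> row_init (err_prop a (cyc_inv m x X)) (i + m * p)"
  unfolding row_init_err_cyc_inv[OF m X(1)] div_mod_add_mult[OF m]
  by (intro add_left_mono mult_left_mono add_mono X(2) E) (auto simp: gsum_nonneg)

section \<open>Closed forms for one mode, with \<open>a\<close> standing for
  \<open>lam 0 k ^ m 0\<close> and \<open>K\<close> for \<open>N 3 - 1\<close>\<close>

locale three_grid =
  fixes a l1 l2 l3 :: complex and m1 m2 K :: nat
  assumes m: "1 \<le> m1" "1 \<le> m2" and K: "1 \<le> K"
begin

abbreviation "X2 \<equiv> cyc_inv m2 l2 (seq_inv l3)"
abbreviation "X1 \<equiv> cyc_inv m1 l1 X2"
abbreviation "Err \<equiv> err_prop a X1"
text \<open>The index of the last point of level 1, hence one less than the number of points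
  there.\<close>

abbreviation "N1 \<equiv> m1 * (m2 * K)"
abbreviation "a1 \<equiv> cmod (l1 - a)"
abbreviation "a2 \<equiv> cmod (l2 - a * l1 ^ (m1 - 1))"
abbreviation "a3 \<equiv> cmod (l3 - a * l1 ^ (m1 - 1) * l2 ^ (m2 - 1))"
abbreviation "g1 \<equiv> gsum (cmod l1)"
abbreviation "g2 \<equiv> gsum (cmod l2)"
abbreviation "g3 \<equiv> gsum (cmod l3)"

lemma tri: "lower_tri X2" "unit_diag X2" "lower_tri X1" "unit_diag X1"
  using m by (auto intro!: lower_tri_cyc_inv unit_diag_cyc_inv unit_diag_seq_inv simp del: One_nat_def)

text \<open>Column 0 is a C-point on both levels, so the C-recursion applies twice; the weights met
  on the way are 1, \<open>g1 m1\<close> and \<open>g1 m1 * g2 m2\<close>.\<close>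

lemma col_first:
  "col_weight 1 N1 Err 0 =
    cmod l3 ^ (K - 1) * a3 + a3 * g3 (K - 1) * g2 m2 * g1 m1 + a2 * g2 (m2 - 1) * g1 m1 + a1 * g1 (m1 - 1)"
proof -
  have p: "0 < m2 * K" "0 < K" using m K by auto
  show ?thesis
    using col_weight_err_C[OF m(1) tri(2) p(1), of 1 a l1]
      col_weight_err_C[OF m(2) unit_diag_seq_inv p(2), of "g1 m1" "a * l1 ^ (m1 - 1)" l2 l3]
      col_weight_err_seq_inv[OF p(2)]
    by (simp add: algebra_simps)
qed

text \<open>Point \<open>m2 - j\<close> lies \<open>j\<close> steps before the C-point of coarse
  index 1. The weight stays free, since level 1 supplies \<open>g1 m1\<close> for it.\<close>

lemma col_weight_X2:
  assumes "j < m2"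
  shows "col_weight w (m2 * K) X2 (m2 - j) =
    w * g2 j + cmod l2 ^ j * (w * g2 m2 * g3 (K - 1) + cmod l3 ^ (K - 1))"
proof -
  have c: "cdiv (m2 - j) m2 = 1" using assms by (intro cdiv_alt) auto
  moreover have "m2 * 1 - (m2 - j) = j" using assms by simp
  ultimately show ?thesis
    using col_weight_cyc_inv[OF m(2) lower_tri_seq_inv, of "m2 - j" K w l2 l3] K
      col_weight_seq_inv[OF K]
    by (simp only:)
qed

text \<open>The point is a C-point on level 1 and an F-point on level 2. The F-step on level 2 moves
  one column to the right, to distance \<open>j - 1\<close> from the C-point; later rows carry the
  weight \<open>g1 m1\<close> of complete level-1 intervals.\<close>

lemma col_C:
  assumes "1 \<le> j" "j < m2"
  shows "col_weight 1 N1 Err (m1 * (m2 - j)) =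
    a2 * g2 (j - 1) * g1 m1 + a1 * g1 (m1 - 1)
    + cmod l2 ^ (j - 1) * a2 * (cmod l3 ^ (K - 1) + g3 (K - 1) * g2 m2 * g1 m1)"
proof -
  have "m2 * 1 \<le> m2 * K" using K by (intro mult_le_mono2)
  then have p: "m2 - j < m2 * K" using assms by linarith
  have F: "\<not> m2 dvd m2 - j" using assms by (auto dest: dvd_imp_le)
  have "Suc (m2 - j) = m2 - (j - 1)" using assms by simp
  then show ?thesis
    using col_weight_err_C[OF m(1) tri(2) p, of 1 a l1] col_weight_err_F[OF m(2) F]
      col_weight_X2[of "j - 1" "g1 m1"] assms
    by (simp add: algebra_simps)
qed

text \<open>An F-point of level 1 at distance \<open>r + 1\<close> from its C-point
  \<open>m1 * (m2 - j)\<close>. The F-step reduces the distance to \<open>r\<close>, and the factor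
  \<open>cmod l1 ^ r\<close> then multiplies the whole coarse column sum.\<close>

lemma col_F:
  assumes "j < m2" "r + 1 < m1"
  shows "col_weight 1 N1 Err (m1 * (m2 - j) - r - 1) =
    a1 * (cmod l1 ^ r * g1 m1 * g2 j + g1 r)
    + cmod l2 ^ j * cmod l1 ^ r * a1 * (cmod l3 ^ (K - 1) + g3 (K - 1) * g2 m2 * g1 m1)"
proof -
  obtain c where c: "m2 - j = Suc c" using assms by (cases "m2 - j") auto
  let ?i = "m1 * (m2 - j) - r - 1"
  have i: "?i = m1 * c + (m1 - r - 1)" "Suc ?i = m1 * (m2 - j) - r" using c assms by auto
  have F: "\<not> m1 dvd ?i" 
    unfolding i(1) dvd_add_right_iff[OF dvd_triv_left] using assms by (auto dest: dvd_imp_le)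
  have cd: "cdiv (Suc ?i) m1 = m2 - j"
    unfolding i(2) using assms c by (intro cdiv_alt) (auto simp: mult.commute)
  have gap: "m1 * (m2 - j) - Suc ?i = r" unfolding i(2) using assms c by simp
  have "m2 * 1 \<le> m2 * K" using K by (intro mult_le_mono2)
  then have le: "cdiv (Suc ?i) m1 \<le> m2 * K" unfolding cd by linarith
  show ?thesis
    using col_weight_err_F[OF m(1) F, of 1 N1 a l1 X2]
      col_weight_cyc_inv[OF m(1) tri(1) le, of 1 l1] col_weight_X2[OF assms(1), of "1 * g1 m1"]
    unfolding cd gap by (simp add: algebra_simps)
qed

lemma col_mono:
  assumes "j + m1 * m2 \<le> N1"
  shows "col_weight 1 N1 Err (j + m1 * m2) \<le> col_weight 1 N1 Err j"
proof -
  have "cols_decrease (m1 * (m2 * 1)) N1 Err"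
    using m by (intro cols_decrease_err_cyc_inv cols_decrease_cyc_inv cols_decrease_seq_inv
        cols_decrease_err_seq_inv tri lower_tri_seq_inv unit_diag_seq_inv)
  then show ?thesis using assms unfolding cols_decrease_def by simp
qed

lemma row_last:
  "row_init Err N1 = g3 K * (a1 * g2 m2 * g1 (m1 - 1) + a2 * g2 (m2 - 1) + a3)"
  using m by (simp add: row_init_err_cyc_inv row_tail_cyc_inv tri unit_diag_seq_inv
      row_init_err_seq_inv row_tail_seq_inv algebra_simps)

text \<open>Coordinates of the last coarsest interval: index \<open>K - 1\<close> on level 3, offset
  \<open>j\<close> on level 2, offset \<open>r\<close> on level 1. One formula covers C-points
  (\<open>r = 0\<close>) and F-points of level 1.\<close>

lemma row_interval:
  assumes "j < m2" "r < m1"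
  shows "row_init Err (m1 * (m2 * (K - 1) + j) + r) =
    a1 * g1 r + cmod l1 ^ r * (
      g2 j * (a1 * g1 (m1 - 1) + a2)
      + cmod l2 ^ j * g3 (K - 1) * (a1 * g2 m2 * g1 (m1 - 1) + a2 * g2 (m2 - 1) + a3))"
proof -
  let ?q = "m2 * (K - 1) + j"
  have "(m1 * ?q + r) div m1 = ?q" "(m1 * ?q + r) mod m1 = r" "?q div m2 = K - 1" "?q mod m2 = j"
    using assms by simp_all
  then show ?thesis unfolding row_init_err_cyc_inv[OF m(1) tri(2)]
      row_init_err_cyc_inv[OF m(2) unit_diag_seq_inv] row_tail_cyc_inv[OF m(2)]
      row_init_err_seq_inv row_tail_seq_inv
    by (simp only:) (simp add: algebra_simps)
qed

lemma row_mono: "row_init Err i \<le> row_init Err (i + m1 * m2)"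
proof -
  have "row_init Err i \<le> row_init Err (i + m1 * (m2 * 1))"
    using m by (intro row_init_err_cyc_inv_mono row_tail_cyc_inv_mono tri unit_diag_seq_inv)
      (auto simp: row_tail_seq_inv row_init_err_seq_inv mult_left_mono)
  then show ?thesis by simp
qed

end

section \<open>Reduction of a maximum to one period, and estimates for the 2-norm\<close>

lemma Max_period_first:
  fixes f :: "nat \<Rightarrow> real"
  assumes step: "\<And>j. j + p < n \<Longrightarrow> f (j + p) \<le> f j" and p: "0 < p" and j: "j < n"
  shows "\<exists>i<p. i < n \<and> f j \<le> f i"
  using j
proof (induction j rule: less_induct)
  case (less j)
  show ?case
  proof (cases "j < p")
    case False
    then have "f j \<le> f (j - p)" using step[of "j - p"] less.prems by simp
    moreover obtain i where "i < p" "i < n" "f (j - p) \<le> f i"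
      using less.IH[of "j - p"] False p less.prems by (metis diff_less less_imp_diff_less not_less
          order_le_less_trans order_less_le_trans)
    ultimately show ?thesis using order_trans by blast
  qed (use less.prems in blast)
qed

lemma Max_period_last:
  fixes f :: "nat \<Rightarrow> real"
  assumes step: "\<And>j. f j \<le> f (j + p)" and p: "0 < p" and j: "j < n"
  shows "\<exists>i. n - p \<le> i \<and> i < n \<and> f j \<le> f i"
  using j
proof (induction "n - j" arbitrary: j rule: less_induct)
  case less
  show ?case
  proof (cases "n - p \<le> j")
    case False
    then obtain i where "n - p \<le> i" "i < n" "f (j + p) \<le> f i"
      using less.hyps[of "j + p"] p less.prems by fastforce
    then show ?thesis using step[of j] order_trans by blast
  qed (use less.prems in blast)
qed

text \<open>Parseval: after expanding the squares, orthonormality of the columns of \<open>v\<close>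
  removes all mixed terms.\<close>

lemma sum_norm_orthonormal:
  fixes v :: "nat \<Rightarrow> nat \<Rightarrow> complex"
  assumes v: "\<And>k k'. k < n \<Longrightarrow> k' < n \<Longrightarrow> (\<Sum>p<n. cnj (v p k) * v p k') = (if k = k' then 1 else 0)"
  shows "(\<Sum>p<n. (cmod (\<Sum>k<n. v p k * w k))\<^sup>2) = (\<Sum>k<n. (cmod (w k))\<^sup>2)"
proof -
  have "complex_of_real (\<Sum>p<n. (cmod (\<Sum>k<n. v p k * w k))\<^sup>2)
      = (\<Sum>p<n. cnj (\<Sum>k<n. v p k * w k) * (\<Sum>k<n. v p k * w k))"
    by (simp only: of_real_sum complex_norm_square mult.commute)
  also have "\<dots> = (\<Sum>p<n. \<Sum>k<n. \<Sum>k'<n. cnj (w k) * w k' * (cnj (v p k) * v p k'))"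
    unfolding cnj_sum sum_product by (intro sum.cong refl) (simp add: algebra_simps)
  also have "\<dots> = (\<Sum>k<n. \<Sum>p<n. \<Sum>k'<n. cnj (w k) * w k' * (cnj (v p k) * v p k'))"
    by (rule sum.swap)
  also have "\<dots> = (\<Sum>k<n. \<Sum>k'<n. \<Sum>p<n. cnj (w k) * w k' * (cnj (v p k) * v p k'))"
    by (intro sum.cong refl sum.swap)
  also have "\<dots> = (\<Sum>k<n. \<Sum>k'<n. if k' = k then cnj (w k) * w k else 0)"
    unfolding sum_distrib_left[symmetric] by (intro sum.cong refl) (auto simp: v)
  also have "\<dots> = complex_of_real (\<Sum>k<n. (cmod (w k))\<^sup>2)"
    by (simp add: complex_norm_square mult.commute del: of_real_power)
  finally show ?thesis by (simp only: of_real_eq_iff)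
qed

text \<open>Each coefficient is split as a product of two square roots. Cauchy-Schwarz then bounds a
  row by its absolute sum times a weighted sum of squares, and exchanging the summations brings in
  the column sums.\<close>

lemma schur_test:
  fixes f :: "nat \<Rightarrow> nat \<Rightarrow> complex"
  assumes R: "\<And>i. i < n \<Longrightarrow> (\<Sum>j<n. cmod (f i j)) \<le> R"
    and C: "\<And>j. j < n \<Longrightarrow> (\<Sum>i<n. cmod (f i j)) \<le> C" and R0: "0 \<le> R"
  shows "(\<Sum>i<n. (cmod (\<Sum>j<n. f i j * z j))\<^sup>2) \<le> R * C * (\<Sum>j<n. (cmod (z j))\<^sup>2)"
proof -
  have row: "(cmod (\<Sum>j<n. f i j * z j))\<^sup>2 \<le> R * (\<Sum>j<n. cmod (f i j) * (cmod (z j))\<^sup>2)" if "i < n" for i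
  proof -
    have "cmod (\<Sum>j<n. f i j * z j) \<le> (\<Sum>j<n. sqrt (cmod (f i j)) * (sqrt (cmod (f i j)) * cmod (z j)))"
      using norm_sum[of "\<lambda>j. f i j * z j" "{..<n}"]
      by (simp add: norm_mult mult.assoc[symmetric])
    then have "(cmod (\<Sum>j<n. f i j * z j))\<^sup>2
        \<le> (\<Sum>j<n. sqrt (cmod (f i j)) * (sqrt (cmod (f i j)) * cmod (z j)))\<^sup>2"
      by (intro power_mono) auto
    also have "\<dots> \<le> (\<Sum>j<n. (sqrt (cmod (f i j)))\<^sup>2) * (\<Sum>j<n. (sqrt (cmod (f i j)) * cmod (z j))\<^sup>2)"
      by (rule Cauchy_Schwarz_ineq_sum)
    also have "\<dots> = (\<Sum>j<n. cmod (f i j)) * (\<Sum>j<n. cmod (f i j) * (cmod (z j))\<^sup>2)"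
      by (simp add: power_mult_distrib)
    also have "\<dots> \<le> R * (\<Sum>j<n. cmod (f i j) * (cmod (z j))\<^sup>2)"
      using R[OF that] by (intro mult_right_mono sum_nonneg) auto
    finally show ?thesis .
  qed
  have "(\<Sum>i<n. (cmod (\<Sum>j<n. f i j * z j))\<^sup>2) \<le> (\<Sum>i<n. R * (\<Sum>j<n. cmod (f i j) * (cmod (z j))\<^sup>2))"
    using row by (intro sum_mono) simp
  also have "\<dots> = R * (\<Sum>i<n. \<Sum>j<n. cmod (f i j) * (cmod (z j))\<^sup>2)"
    by (simp add: sum_distrib_left)
  also have "\<dots> = R * (\<Sum>j<n. \<Sum>i<n. cmod (f i j) * (cmod (z j))\<^sup>2)"
    by (subst sum.swap) (rule refl)
  also have "\<dots> = R * (\<Sum>j<n. (\<Sum>i<n. cmod (f i j)) * (cmod (z j))\<^sup>2)"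
    by (simp add: sum_distrib_right)
  also have "\<dots> \<le> R * (\<Sum>j<n. C * (cmod (z j))\<^sup>2)"
    using C R0 by (intro mult_left_mono sum_mono mult_right_mono) auto
  finally show ?thesis by (simp add: sum_distrib_left mult.assoc)
qed

section \<open>Block matrices that are diagonal in a common unitary basis\<close>

text \<open>\<open>u p k\<close> is component \<open>p\<close> of eigenvector \<open>k\<close>.
  \<open>orthonormal\<close> collapses products of operators to single modes;
  \<open>complete\<close> recognises blocks that are multiples of the identity.\<close>

locale mode_basis =
  fixes Nx :: nat and u :: "nat \<Rightarrow> nat \<Rightarrow> complex"
  assumes Nx: "0 < Nx"
    and orthonormal: "\<And>k k'. k < Nx \<Longrightarrow> k' < Nx \<Longrightarrow>
      (\<Sum>p<Nx. cnj (u p k) * u p k') = (if k = k' then 1 else 0)"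
    and complete: "\<And>p q. p < Nx \<Longrightarrow> q < Nx \<Longrightarrow>
      (\<Sum>k<Nx. u p k * cnj (u q k)) = (if p = q then 1 else 0)"
begin

text \<open>Every block is diagonal in the common basis, with the numbers \<open>f k i j\<close> as
  eigenvalues. The operator calculus thus reduces to one scalar matrix \<open>f k\<close> per
  mode.\<close>

definition mode_mat :: "nat \<Rightarrow> nat \<Rightarrow> (nat \<Rightarrow> nat \<Rightarrow> nat \<Rightarrow> complex) \<Rightarrow> complex mat" where
  "mode_mat nr nc f = mat (nr * Nx) (nc * Nx) (\<lambda>(r, c).
     \<Sum>k<Nx. u (r mod Nx) k * f k (r div Nx) (c div Nx) * cnj (u (c mod Nx) k))"

lemma mode_mat_carrier [simp, intro]: "mode_mat nr nc f \<in> carrier_mat (nr * Nx) (nc * Nx)"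
  by (simp add: mode_mat_def)

lemma mode_mat_dim [simp]: "dim_row (mode_mat nr nc f) = nr * Nx" "dim_col (mode_mat nr nc f) = nc * Nx"
  by (simp_all add: mode_mat_def)

lemma flat_less: "r < n * Nx \<Longrightarrow> r div Nx < n" "r mod Nx < Nx"
  using Nx by (simp_all add: less_mult_imp_div_less)

lemma sum_flat: "(\<Sum>s<n * Nx. F (s div Nx) (s mod Nx)) = (\<Sum>l<n. \<Sum>q<Nx. F l q)"
  for F :: "nat \<Rightarrow> nat \<Rightarrow> 'a::comm_monoid_add"
  unfolding sum_block by (intro sum.cong refl) auto

lemma mode_mat_cong:
  assumes "\<And>k i j. k < Nx \<Longrightarrow> i < nr \<Longrightarrow> j < nc \<Longrightarrow> f k i j = g k i j"
  shows "mode_mat nr nc f = mode_mat nr nc g"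
  unfolding mode_mat_def using assms flat_less by (auto intro!: cong_mat sum.cong)

text \<open>The inner flat index is split into a block and a position; summing over the position
  leaves, by orthonormality, only products of equal modes.\<close>

lemma mode_mat_mult:
  "mode_mat nr n f * mode_mat n nc g = mode_mat nr nc (\<lambda>k i j. \<Sum>l<n. f k i l * g k l j)"
proof (rule eq_matI)
  fix r c assume "r < dim_row (mode_mat nr nc (\<lambda>k i j. \<Sum>l<n. f k i l * g k l j))"
    and "c < dim_col (mode_mat nr nc (\<lambda>k i j. \<Sum>l<n. f k i l * g k l j))"
  then have rc: "r < nr * Nx" "c < nc * Nx" by simp_all
  let ?i = "r div Nx" and ?p = "r mod Nx" and ?j = "c div Nx" and ?q = "c mod Nx"
  have inner: "(\<Sum>s<Nx. (\<Sum>k<Nx. u ?p k * f k ?i l * cnj (u s k)) * (\<Sum>k<Nx. u s k * g k l ?j * cnj (u ?q k)))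
      = (\<Sum>k<Nx. u ?p k * (f k ?i l * g k l ?j) * cnj (u ?q k))" for l
  proof -
    have "(\<Sum>s<Nx. (\<Sum>k<Nx. u ?p k * f k ?i l * cnj (u s k)) * (\<Sum>k<Nx. u s k * g k l ?j * cnj (u ?q k)))
        = (\<Sum>s<Nx. \<Sum>k<Nx. \<Sum>k'<Nx. u ?p k * f k ?i l * (g k' l ?j * cnj (u ?q k')) * (cnj (u s k) * u s k'))"
      unfolding sum_product by (intro sum.cong refl) (simp add: algebra_simps)
    also have "\<dots> = (\<Sum>k<Nx. \<Sum>s<Nx. \<Sum>k'<Nx. u ?p k * f k ?i l * (g k' l ?j * cnj (u ?q k')) * (cnj (u s k) * u s k'))"
      by (rule sum.swap)
    also have "\<dots> = (\<Sum>k<Nx. \<Sum>k'<Nx. \<Sum>s<Nx. u ?p k * f k ?i l * (g k' l ?j * cnj (u ?q k')) * (cnj (u s k) * u s k'))"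
      by (intro sum.cong refl sum.swap)
    also have "\<dots> = (\<Sum>k<Nx. \<Sum>k'<Nx. if k' = k then u ?p k * f k ?i l * (g k l ?j * cnj (u ?q k)) else 0)"
      unfolding sum_distrib_left[symmetric] by (intro sum.cong refl) (auto simp: orthonormal)
    also have "\<dots> = (\<Sum>k<Nx. u ?p k * (f k ?i l * g k l ?j) * cnj (u ?q k))"
      by (intro sum.cong refl) (simp add: mult.assoc)
    finally show ?thesis .
  qed
  have "(mode_mat nr n f * mode_mat n nc g) $$ (r, c)
      = (\<Sum>s<n * Nx. mode_mat nr n f $$ (r, s) * mode_mat n nc g $$ (s, c))"
    using rc by (simp add: scalar_prod_def atLeast0LessThan)
  also have "\<dots> = (\<Sum>s<n * Nx. (\<Sum>k<Nx. u ?p k * f k ?i (s div Nx) * cnj (u (s mod Nx) k))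
      * (\<Sum>k<Nx. u (s mod Nx) k * g k (s div Nx) ?j * cnj (u ?q k)))"
    using rc by (intro sum.cong refl) (simp add: mode_mat_def)
  also have "\<dots> = (\<Sum>l<n. \<Sum>k<Nx. u ?p k * (f k ?i l * g k l ?j) * cnj (u ?q k))"
    by (subst sum_flat[where F = "\<lambda>l s. (\<Sum>k<Nx. u ?p k * f k ?i l * cnj (u s k))
      * (\<Sum>k<Nx. u s k * g k l ?j * cnj (u ?q k))"]) (simp only: inner)
  also have "\<dots> = (\<Sum>k<Nx. \<Sum>l<n. u ?p k * (f k ?i l * g k l ?j) * cnj (u ?q k))"
    by (rule sum.swap)
  also have "\<dots> = mode_mat nr nc (\<lambda>k i j. \<Sum>l<n. f k i l * g k l j) $$ (r, c)"
    using rc by (simp add: mode_mat_def sum_distrib_left sum_distrib_right)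
  finally show "(mode_mat nr n f * mode_mat n nc g) $$ (r, c)
    = mode_mat nr nc (\<lambda>k i j. \<Sum>l<n. f k i l * g k l j) $$ (r, c)" .
qed auto

lemma mode_mat_add:
  "mode_mat nr nc f + mode_mat nr nc g = mode_mat nr nc (\<lambda>k i j. f k i j + g k i j)"
  by (rule eq_matI) (auto simp: mode_mat_def algebra_simps sum.distrib)

lemma mode_mat_diff:
  "mode_mat nr nc f - mode_mat nr nc g = mode_mat nr nc (\<lambda>k i j. f k i j - g k i j)"
  by (rule eq_matI) (auto simp: mode_mat_def algebra_simps sum_subtractf)

lemma mode_mat_scalar_entry:
  assumes "r < nr * Nx" "c < nc * Nx"
  shows "mode_mat nr nc (\<lambda>k. f) $$ (r, c) =
    (if r mod Nx = c mod Nx then f (r div Nx) (c div Nx) else 0)"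
proof -
  have "mode_mat nr nc (\<lambda>k. f) $$ (r, c) =
      f (r div Nx) (c div Nx) * (\<Sum>k<Nx. u (r mod Nx) k * cnj (u (c mod Nx) k))"
    using assms by (simp add: mode_mat_def sum_distrib_left algebra_simps)
  then show ?thesis using complete flat_less(2) by simp
qed

lemma mode_mat_one: "1\<^sub>m (n * Nx) = mode_mat n n (\<lambda>k i j. if i = j then 1 else 0)"
proof (rule eq_matI)
  fix r c assume "r < dim_row (mode_mat n n (\<lambda>k i j. if i = j then 1 else 0))"
    "c < dim_col (mode_mat n n (\<lambda>k i j. if i = j then 1 else 0))"
  then have rc: "r < n * Nx" "c < n * Nx" by simp_all
  have "r = c \<longleftrightarrow> r div Nx = c div Nx \<and> r mod Nx = c mod Nx"
    by (metis mult_div_mod_eq)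
  then show "1\<^sub>m (n * Nx) $$ (r, c) = mode_mat n n (\<lambda>k i j. if i = j then 1 else 0) $$ (r, c)"
    using rc by (simp add: mode_mat_scalar_entry)
qed auto

text \<open>The entries are the same for every mode, so the blocks are multiples of the identity.
  For mode-dependent entries the plain transpose would replace the basis by its conjugate.\<close>

lemma mode_mat_transpose: "transpose_mat (mode_mat nr nc (\<lambda>k. f)) = mode_mat nc nr (\<lambda>k i j. f j i)"
  by (rule eq_matI) (auto simp: mode_mat_scalar_entry)

lemma block_mat_eq_mode_mat:
  assumes "\<And>i j p q. i < nr \<Longrightarrow> j < nc \<Longrightarrow> p < Nx \<Longrightarrow> q < Nx \<Longrightarrow>
    B i j $$ (p, q) = (\<Sum>k<Nx. u p k * f k i j * cnj (u q k))"
  shows "block_mat Nx nr nc B = mode_mat nr nc f"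
  unfolding block_mat_def mode_mat_def using assms flat_less by (auto intro!: cong_mat)

text \<open>A right inverse found mode by mode is two-sided because the matrix is square, and
  inverses are unique.\<close>

lemma minv_mode_mat:
  assumes "\<And>k i j. k < Nx \<Longrightarrow> i < n \<Longrightarrow> j < n \<Longrightarrow>
    (\<Sum>l<n. f k i l * g k l j) = (if i = j then 1 else 0)"
  shows "minv (mode_mat n n f) = mode_mat n n g"
proof -
  let ?A = "mode_mat n n f" and ?B = "mode_mat n n g"
  have AB: "?A * ?B = 1\<^sub>m (n * Nx)"
    unfolding mode_mat_mult mode_mat_one by (rule mode_mat_cong) (rule assms)
  then have BA: "?B * ?A = 1\<^sub>m (n * Nx)"
    by (rule mat_mult_left_right_inverse[OF mode_mat_carrier mode_mat_carrier])
  \<comment> \<open>\<open>mat_inverse\<close> yields \<open>None\<close> only for non-units, so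
    \<open>the\<close> in \<open>minv\<close> has a value here.\<close>
  have "?A \<in> Units (ring_mat TYPE(complex) (n * Nx) ())"
    unfolding Units_def using AB BA by (auto simp: ring_mat_def intro!: bexI[of _ ?B])
  then obtain C where C: "mat_inverse ?A = Some C"
    using mat_inverse(1)[OF mode_mat_carrier[of n n f], where b = "()"] by (cases "mat_inverse ?A") auto
  then have "C * ?A = 1\<^sub>m (n * Nx)" "C \<in> carrier_mat (n * Nx) (n * Nx)"
    using mat_inverse(2)[OF mode_mat_carrier] by blast+
  then have "C = ?B"
    using AB by (metis assoc_mult_mat left_mult_one_mat mode_mat_carrier right_mult_one_mat)
  then show ?thesis unfolding minv_def C by simp
qed

lemma norm_2_flat:
  assumes "dim_vec v = n * Nx"
  shows "(norm_2 v)\<^sup>2 = (\<Sum>i<n. \<Sum>p<Nx. (cmod (v $ (Nx * i + p)))\<^sup>2)"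
  unfolding norm_2_def assms sum_block by (simp add: sum_nonneg)

text \<open>Passing from positions to the mode coefficients \<open>z\<close> and back preserves the
  2-norm, so the Schur test can be applied to each mode separately.\<close>

lemma norm_2_mode_mat_le:
  assumes y: "y \<in> carrier_vec (n * Nx)"
    and R: "\<And>k i. k < Nx \<Longrightarrow> i < n \<Longrightarrow> (\<Sum>j<n. cmod (f k i j)) \<le> R"
    and C: "\<And>k j. k < Nx \<Longrightarrow> j < n \<Longrightarrow> (\<Sum>i<n. cmod (f k i j)) \<le> C"
    and RC: "0 \<le> R" "0 \<le> C"
  shows "norm_2 (mode_mat n n f *\<^sub>v y) \<le> sqrt (R * C) * norm_2 y"
proof -
  define z where "z k j = (\<Sum>q<Nx. cnj (u q k) * y $ (Nx * j + q))" for k j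
  have entry: "(mode_mat n n f *\<^sub>v y) $ (Nx * i + p) = (\<Sum>k<Nx. u p k * (\<Sum>j<n. f k i j * z k j))"
    if ip: "i < n" "p < Nx" for i p
  proof -
    have "Nx * i + p < Nx * Suc i" using ip by simp
    also have "\<dots> \<le> Nx * n" using ip by (intro mult_le_mono2) auto
    finally have r: "Nx * i + p < n * Nx" by (simp add: mult.commute)
    have "(mode_mat n n f *\<^sub>v y) $ (Nx * i + p)
        = (\<Sum>s<n * Nx. mode_mat n n f $$ (Nx * i + p, s) * y $ s)"
      using r y by (simp add: scalar_prod_def atLeast0LessThan)
    also have "\<dots> = (\<Sum>s<n * Nx. (\<Sum>k<Nx. u p k * f k i (s div Nx) * cnj (u (s mod Nx) k))
        * y $ (Nx * (s div Nx) + s mod Nx))"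
      using r ip by (intro sum.cong refl) (simp add: mode_mat_def)
    also have "\<dots> = (\<Sum>j<n. \<Sum>q<Nx. (\<Sum>k<Nx. u p k * f k i j * cnj (u q k)) * y $ (Nx * j + q))"
      by (rule sum_flat)
    also have "\<dots> = (\<Sum>j<n. \<Sum>k<Nx. u p k * (f k i j * z k j))"
      unfolding sum_distrib_right
      by (subst sum.swap) (simp add: z_def sum_distrib_left algebra_simps)
    also have "\<dots> = (\<Sum>k<Nx. u p k * (\<Sum>j<n. f k i j * z k j))"
      by (subst sum.swap) (simp add: sum_distrib_left)
    finally show ?thesis .
  qed
  have "(norm_2 (mode_mat n n f *\<^sub>v y))\<^sup>2
      = (\<Sum>i<n. \<Sum>p<Nx. (cmod (\<Sum>k<Nx. u p k * (\<Sum>j<n. f k i j * z k j)))\<^sup>2)"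
    by (subst norm_2_flat[where n = n]) (auto intro!: sum.cong simp: entry)
  also have "\<dots> = (\<Sum>i<n. \<Sum>k<Nx. (cmod (\<Sum>j<n. f k i j * z k j))\<^sup>2)"
    by (intro sum.cong refl sum_norm_orthonormal orthonormal)
  also have "\<dots> = (\<Sum>k<Nx. \<Sum>i<n. (cmod (\<Sum>j<n. f k i j * z k j))\<^sup>2)"
    by (rule sum.swap)
  also have "\<dots> \<le> (\<Sum>k<Nx. R * C * (\<Sum>j<n. (cmod (z k j))\<^sup>2))"
    using R C RC by (intro sum_mono schur_test) auto
  also have "\<dots> = R * C * (\<Sum>j<n. \<Sum>k<Nx. (cmod (z k j))\<^sup>2)"
    by (subst sum.swap) (simp add: sum_distrib_left)
  \<comment> \<open>Modes and positions exchange their roles here, hence \<open>complete\<close>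
    supplies the orthonormality.\<close>
  also have "(\<Sum>j<n. \<Sum>k<Nx. (cmod (z k j))\<^sup>2) = (\<Sum>j<n. \<Sum>q<Nx. (cmod (y $ (Nx * j + q)))\<^sup>2)"
    unfolding z_def
    by (intro sum.cong refl sum_norm_orthonormal[where v = "\<lambda>k q. cnj (u q k)"]) (simp add: complete)
  also have "\<dots> = (norm_2 y)\<^sup>2" using y by (subst norm_2_flat[where n = n]) auto
  finally have "(norm_2 (mode_mat n n f *\<^sub>v y))\<^sup>2 \<le> (sqrt (R * C) * norm_2 y)\<^sup>2"
    using RC by (simp add: power_mult_distrib)
  moreover have "0 \<le> sqrt (R * C) * norm_2 y" using RC by (simp add: norm_2_def sum_nonneg)
  ultimately show ?thesis by (rule power2_le_imp_le)
qed

end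

section \<open>The multigrid operators\<close>

definition bidiag :: "complex \<Rightarrow> nat \<Rightarrow> nat \<Rightarrow> complex" where
  "bidiag x i j = (if i = j then 1 else if i = Suc j then - x else 0)"

lemma sum_bidiag_left:
  assumes "i < n"
  shows "(\<Sum>l<n. bidiag x i l * f l) = f i - (if i = 0 then 0 else x * f (i - 1))"
proof (cases i)
  case 0
  have "(\<Sum>l<n. bidiag x i l * f l) = (\<Sum>l<n. if l = i then f l else 0)"
    by (intro sum.cong refl) (auto simp: bidiag_def 0)
  then show ?thesis using assms 0 by simp
next
  case (Suc i')
  have "(\<Sum>l<n. bidiag x i l * f l) = (\<Sum>l<n. (if l = i then f l else 0) + (if l = i' then - x * f l else 0))"
    by (intro sum.cong refl) (auto simp: bidiag_def Suc)
  then show ?thesis using assms Suc by (simp add: sum.distrib)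
qed

lemma sum_bidiag_right:
  assumes "j < n"
  shows "(\<Sum>l<n. f l * bidiag x l j) = f j - (if Suc j < n then x * f (Suc j) else 0)"
proof -
  have "(\<Sum>l<n. f l * bidiag x l j) = (\<Sum>l<n. (if l = j then f l else 0) + (if l = Suc j then - x * f l else 0))"
    by (intro sum.cong refl) (auto simp: bidiag_def)
  then show ?thesis using assms by (simp add: sum.distrib)
qed

lemma bidiag_seq_inv:
  assumes "i < n" "j < n"
  shows "(\<Sum>l<n. bidiag x i l * seq_inv x l j) = (if i = j then 1 else 0)"
proof -
  have "x ^ (i - j) = x * x ^ (i - 1 - j)" if "j < i"
    using that by (metis Suc_diff_Suc diff_Suc_eq_diff_pred power_Suc)
  then show ?thesis unfolding sum_bidiag_left[OF assms(1)] by (auto simp: seq_inv_def)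
qed

text \<open>The effect of F-relaxation: an exact solve inside each interval. Being zero at C-points,
  it lets sums over F-points run over the whole grid.\<close>

definition F_inv :: "nat \<Rightarrow> complex \<Rightarrow> nat \<Rightarrow> nat \<Rightarrow> complex" where
  "F_inv m x i j = (if \<not> m dvd i \<and> \<not> m dvd j \<and> j \<le> i \<and> i div m = j div m then x ^ (i - j) else 0)"

lemma bidiag_F_inv:
  assumes m: "1 \<le> m" and ij: "\<not> m dvd i" "\<not> m dvd j" "i < n"
  shows "(\<Sum>l<n. bidiag x i l * F_inv m x l j) = (if i = j then 1 else 0)"
proof -
  obtain c s where c: "i = Suc (m * c + s)" "Suc s < m" "c = i div m" using ij(1) m by (rule not_dvdE)
  have "(m * c + s) div m = c" using c(2) by simp
  then have d: "(i - 1) div m = i div m" unfolding c(3)[symmetric] using c(1) by simp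
  have p: "x ^ (i - j) = x * x ^ (i - 1 - j)" if "j < i"
    using that by (metis Suc_diff_Suc diff_Suc_eq_diff_pred power_Suc)
  \<comment> \<open>If \<open>i - 1\<close> were a C-point, a point \<open>j < i\<close> of the same
    interval would have to be that C-point.\<close>
  have e: "\<not> m dvd i - 1" if "j < i" "i div m = j div m"
  proof
    assume "m dvd i - 1"
    then have "m * (i div m) = i - 1" using d by (metis dvd_mult_div_cancel)
    moreover have "m * (j div m) \<le> j" by simp
    ultimately have "m * (j div m) = j" using that by simp
    then show False using ij(2) by (metis dvd_triv_left)
  qed
  show ?thesis unfolding sum_bidiag_left[OF ij(3)] F_inv_def d
    using c(1) ij p e by (cases "j < i"; cases "i = j") auto
qed

text \<open>If a C-point separates \<open>j\<close> from \<open>i\<close>, F-relaxation does not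
  connect them; otherwise the coarse term meets the strict upper triangle of \<open>X\<close>. The
  sum is therefore the case distinction of \<open>cyc_inv\<close>.\<close>

lemma F_inv_plus_coarse:
  assumes m: "1 \<le> m" and X: "lower_tri X"
  shows "F_inv m x i j + x ^ (i mod m) * X (i div m) (cdiv j m) * x ^ (m * cdiv j m - j) = cyc_inv m x X i j"
proof (cases "j \<le> m * (i div m)")
  case True
  have "F_inv m x i j = 0"
  proof (rule ccontr)
    assume "F_inv m x i j \<noteq> 0"
    then have "\<not> m dvd j" "i div m = j div m" by (auto simp: F_inv_def split: if_splits)
    moreover have "m * (j div m) \<le> j" by simp
    ultimately show False using True by (metis dvd_triv_left le_antisym)
  qed
  then show ?thesis using True by (simp add: cyc_inv_def)
next
  case False
  then have "i div m < cdiv j m" using cdiv_le_iff[OF m] by (metis not_le)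
  then have 0: "X (i div m) (cdiv j m) = 0" using X by (simp add: lower_tri_def)
  have "\<not> m dvd i \<and> \<not> m dvd j \<and> i div m = j div m" if "j \<le> i"
  proof -
    have "j div m \<le> i div m" using that by (rule div_le_mono)
    moreover have "i div m \<le> j div m" using False m
      by (simp add: less_eq_div_iff_mult_less_eq mult.commute)
    ultimately have "i div m = j div m" by simp
    moreover from this False that have "\<not> m dvd j" "\<not> m dvd i"
      by (metis dvd_mult_div_cancel order_refl, metis dvd_mult_div_cancel)
    ultimately show ?thesis by simp
  qed
  then show ?thesis using False 0 by (auto simp: cyc_inv_def F_inv_def)
qed

section \<open>Sums over F-points and C-points\<close>

lemma sum_F_points:
  fixes \<phi> :: "nat \<Rightarrow> 'a::comm_monoid_add"
  shows "(\<Sum>c<length (F_points m N l). \<phi> (F_points m N l ! c)) = (\<Sum>i<N l. if m l dvd i then 0 else \<phi> i)"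
proof -
  have d: "distinct (F_points m N l)" by (simp add: F_points_def)
  have "(\<Sum>c<length (F_points m N l). \<phi> (F_points m N l ! c)) = (\<Sum>i\<in>set (F_points m N l). \<phi> i)"
    using sum.reindex_bij_betw[OF bij_betw_nth[OF d refl refl]] .
  also have "\<dots> = (\<Sum>i<N l. if m l dvd i then 0 else \<phi> i)"
    by (intro sum.mono_neutral_cong_left) (auto simp: F_points_def)
  finally show ?thesis .
qed

lemma F_points_nth:
  assumes "c < length (F_points m N l)"
  shows "\<not> m l dvd F_points m N l ! c" "F_points m N l ! c < N l"
  using nth_mem[OF assms] by (auto simp: F_points_def)

lemma F_points_nth_eq:
  assumes "c < length (F_points m N l)" "d < length (F_points m N l)"
  shows "F_points m N l ! c = F_points m N l ! d \<longleftrightarrow> c = d"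
  using assms by (simp add: F_points_def nth_eq_iff_index_eq)

lemma sum_C_points:
  fixes \<phi> :: "nat \<Rightarrow> 'a::comm_monoid_add"
  assumes m: "1 \<le> m" and n: "1 \<le> n"
  shows "(\<Sum>c<m * (n - 1) + 1. if m dvd c then \<phi> (c div m) else 0) = (\<Sum>l<n. \<phi> l)"
proof -
  have "(\<Sum>l<n. \<phi> l) = (\<Sum>c\<in>(*) m ` {..<n}. \<phi> (c div m))"
    using m by (subst sum.reindex) (auto simp: inj_on_def)
  also have "\<dots> = (\<Sum>c<m * (n - 1) + 1. if m dvd c then \<phi> (c div m) else 0)"
  proof (intro sum.mono_neutral_cong_left ballI)
    show "(*) m ` {..<n} \<subseteq> {..<m * (n - 1) + 1}"
      by (auto simp: less_Suc_eq_le intro!: mult_le_mono2)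
    fix c assume "c \<in> {..<m * (n - 1) + 1} - (*) m ` {..<n}"
    then have "c \<le> m * (n - 1)" "c \<notin> (*) m ` {..<n}" by auto
    have "\<not> m dvd c"
    proof
      assume "m dvd c"
      then obtain l where l: "c = m * l" by blast
      with \<open>c \<le> m * (n - 1)\<close> m have "l \<le> n - 1" by simp
      then show False using l n \<open>c \<notin> (*) m ` {..<n}\<close> by auto
    qed
    then show "(if m dvd c then \<phi> (c div m) else 0) = 0" by simp
  qed auto
  finally show ?thesis by simp
qed

text \<open>To be interpreted twice: in the standard basis for the diagonalized operators, whose
  norms are taken, and in the given unitary basis for the actual iteration.\<close>

locale time_grid = mode_basis +
  fixes m N :: "nat \<Rightarrow> nat" and \<Phi> :: "nat \<Rightarrow> complex mat" and lam :: "nat \<Rightarrow> nat \<Rightarrow> complex"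
  assumes m_pos: "\<And>l. l < 3 \<Longrightarrow> 1 \<le> m l"
    and N_pos: "\<And>l. l \<le> 3 \<Longrightarrow> 1 \<le> N l"
    and N_eq: "\<And>l. l < 3 \<Longrightarrow> N l = m l * (N (Suc l) - 1) + 1"
    and Phi_carrier: "\<And>l. l \<le> 3 \<Longrightarrow> \<Phi> l \<in> carrier_mat Nx Nx"
    and Phi_entry: "\<And>l p q. l \<le> 3 \<Longrightarrow> p < Nx \<Longrightarrow> q < Nx \<Longrightarrow>
      \<Phi> l $$ (p, q) = (\<Sum>k<Nx. u p k * lam l k * cnj (u q k))"
begin

section \<open>The operators of the levels, mode by mode\<close>

lemma Phi_pow:
  assumes "l \<le> 3"
  shows "\<Phi> l ^\<^sub>m n = mode_mat 1 1 (\<lambda>k i j. lam l k ^ n)"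
proof (induction n)
  case 0
  have "\<Phi> l ^\<^sub>m 0 = 1\<^sub>m (1 * Nx)" using Phi_carrier[OF assms] by auto
  also have "\<dots> = mode_mat 1 1 (\<lambda>k i j. lam l k ^ 0)"
    unfolding mode_mat_one by (rule mode_mat_cong) simp
  finally show ?case .
next
  case (Suc n)
  have "\<Phi> l = mode_mat 1 1 (\<lambda>k i j. lam l k)"
    using Phi_carrier[OF assms] Phi_entry[OF assms] by (intro eq_matI) (auto simp: mode_mat_def)
  with Suc show ?case by (simp add: mode_mat_mult mult.commute)
qed

lemma Phi_pow_entry:
  assumes "l \<le> 3" "p < Nx" "q < Nx"
  shows "(\<Phi> l ^\<^sub>m n) $$ (p, q) = (\<Sum>k<Nx. u p k * lam l k ^ n * cnj (u q k))"
  using assms by (simp add: Phi_pow mode_mat_def)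

lemma N_bound:
  assumes "l < 3" "i < N l"
  shows "i div m l < N (Suc l)" "cdiv i (m l) < N (Suc l)"
proof -
  have i: "i \<le> m l * (N (Suc l) - 1)" using assms N_eq[of l] by simp
  then have "i div m l \<le> N (Suc l) - 1"
    using div_le_mono[OF i, of "m l"] m_pos[OF assms(1)] by simp
  moreover have "cdiv i (m l) \<le> N (Suc l) - 1" using i cdiv_le_iff[OF m_pos[OF assms(1)]] by simp
  moreover have "1 \<le> N (Suc l)" using N_pos[of "Suc l"] assms by simp
  ultimately show "i div m l < N (Suc l)" "cdiv i (m l) < N (Suc l)" by linarith+
qed

lemma C_point_bound:
  assumes "l < 3" "j < N (Suc l)"
  shows "m l * j < N l"
proof -
  have "m l * j \<le> m l * (N (Suc l) - 1)" using assms by (intro mult_le_mono2) auto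
  then show ?thesis using N_eq[OF assms(1)] by linarith
qed

lemma A_op_mode: "l \<le> 3 \<Longrightarrow> A_op Nx N \<Phi> l = mode_mat (N l) (N l) (\<lambda>k. bidiag (lam l k))"
  unfolding A_op_def using Phi_carrier[of l]
  by (intro block_mat_eq_mode_mat)
    (auto simp: bidiag_def complete Phi_entry sum_negf mult.assoc)

lemma P_op_mode:
  assumes "l < 3"
  shows "P_op Nx m N \<Phi> l = mode_mat (N l) (N (Suc l))
    (\<lambda>k i j. if j = i div m l then lam l k ^ (i mod m l) else 0)"
proof -
  have "j * m l \<le> i \<and> i < j * m l + m l \<longleftrightarrow> j = i div m l" for i j
  proof
    assume "j * m l \<le> i \<and> i < j * m l + m l"
    then show "j = i div m l" by (intro div_nat_eqI[symmetric]) (simp_all add: mult.commute)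
  next
    assume "j = i div m l"
    moreover have "i mod m l < m l" "i div m l * m l + i mod m l = i"
      using m_pos[OF assms] by simp_all
    ultimately have "j * m l + i mod m l = i" "i mod m l < m l" by simp_all
    then show "j * m l \<le> i \<and> i < j * m l + m l" by (intro conjI) linarith+
  qed
  moreover have "i - i div m l * m l = i mod m l" for i by (simp add: minus_div_mult_eq_mod)
  ultimately show ?thesis unfolding P_op_def
    using assms by (intro block_mat_eq_mode_mat) (auto simp: Phi_pow_entry)
qed

text \<open>The special block row 0 and the remaining rows have one description: column
  \<open>c\<close> is sent to the first C-point at or after \<open>c\<close>, and this is point 0
  only for \<open>c = 0\<close>.\<close>

lemma R_op_mode:
  assumes "l < 3"
  shows "R_op Nx m N \<Phi> l = mode_mat (N (Suc l)) (N l)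
    (\<lambda>k j c. if j = cdiv c (m l) then lam l k ^ (m l * cdiv c (m l) - c) else 0)"
  unfolding R_op_def
proof (rule block_mat_eq_mode_mat)
  fix j c p q assume pq: "p < Nx" "q < Nx"
  have m: "1 \<le> m l" by (rule m_pos[OF assms])
  have 0: "cdiv c (m l) = 0 \<longleftrightarrow> c = 0" using cdiv_le_iff[OF m, of c 0] by simp
  have "(j - 1) * m l < c \<and> c \<le> j * m l \<longleftrightarrow> j = cdiv c (m l)" if "j \<noteq> 0"
  proof -
    have "c \<le> j * m l \<longleftrightarrow> cdiv c (m l) \<le> j" "c \<le> (j - 1) * m l \<longleftrightarrow> cdiv c (m l) \<le> j - 1"
      using cdiv_le_iff[OF m, of c] by (simp_all add: mult.commute)
    then show ?thesis using that by auto
  qed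
  then show "(if j = 0 then (if c = 0 then 1\<^sub>m Nx else 0\<^sub>m Nx Nx)
      else if (j - 1) * m l < c \<and> c \<le> j * m l then \<Phi> l ^\<^sub>m (j * m l - c) else 0\<^sub>m Nx Nx) $$ (p, q)
    = (\<Sum>k<Nx. u p k * (if j = cdiv c (m l) then lam l k ^ (m l * cdiv c (m l) - c) else 0) * cnj (u q k))"
    using 0 pq assms by (cases "j = 0") (auto simp: Phi_pow_entry complete mult.commute[of "m l"])
qed

lemma RI0_op_mode: "RI0_op Nx m N = mode_mat (N 1) (N 0) (\<lambda>k j c. if c = m 0 * j then 1 else 0)"
  unfolding RI0_op_def by (rule block_mat_eq_mode_mat) (auto simp: complete mult.commute)

text \<open>Conjugation with the selection matrix restricts \<open>A\<close> to the F-points. There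
  \<open>F_inv\<close> is its inverse, and selecting back places that inverse on the full
  grid.\<close>

lemma F_relax_mode:
  assumes l: "l < 3"
  shows "F_relax Nx m N \<Phi> l = mode_mat (N l) (N l) (\<lambda>k. F_inv (m l) (lam l k))"
proof -
  let ?F = "F_points m N l" and ?n = "length (F_points m N l)"
  have S: "S_op Nx m N l = mode_mat (N l) ?n (\<lambda>k i c. if i = ?F ! c then 1 else 0)"
    unfolding S_op_def by (rule block_mat_eq_mode_mat) (auto simp: complete)
  have St: "transpose_mat (S_op Nx m N l) = mode_mat ?n (N l) (\<lambda>k c i. if i = ?F ! c then 1 else 0)"
    unfolding S by (rule mode_mat_transpose)
  have "transpose_mat (S_op Nx m N l) * A_op Nx N \<Phi> l * S_op Nx m N l
      = mode_mat ?n ?n (\<lambda>k c d. bidiag (lam l k) (?F ! c) (?F ! d))"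
    unfolding St unfolding S using l
    by (simp add: A_op_mode mode_mat_mult)
      (rule mode_mat_cong, simp add: F_points_nth if_distrib[of "\<lambda>x. x * _"] if_distrib[of "\<lambda>x. _ * x"] cong: if_cong)
  moreover have "minv \<dots> = mode_mat ?n ?n (\<lambda>k c d. F_inv (m l) (lam l k) (?F ! c) (?F ! d))"
  proof (rule minv_mode_mat)
    fix k i j assume ij: "i < ?n" "j < ?n"
    have "(\<Sum>e<?n. bidiag (lam l k) (?F ! i) (?F ! e) * F_inv (m l) (lam l k) (?F ! e) (?F ! j))
        = (\<Sum>e<N l. bidiag (lam l k) (?F ! i) e * F_inv (m l) (lam l k) e (?F ! j))"
      using sum_F_points[of "\<lambda>e. bidiag (lam l k) (?F ! i) e * F_inv (m l) (lam l k) e (?F ! j)" m N l]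
      by (auto simp: F_inv_def intro!: sum.cong)
    also have "\<dots> = (if i = j then 1 else 0)"
      using bidiag_F_inv[OF m_pos[OF l] F_points_nth(1)[OF ij(1)] F_points_nth(1)[OF ij(2)]
          F_points_nth(2)[OF ij(1)], of "lam l k"] F_points_nth_eq[OF ij] by simp
    finally show "(\<Sum>e<?n. bidiag (lam l k) (?F ! i) (?F ! e) * F_inv (m l) (lam l k) (?F ! e) (?F ! j))
      = (if i = j then 1 else 0)" .
  qed
  ultimately have "F_relax Nx m N \<Phi> l = S_op Nx m N l *
      mode_mat ?n ?n (\<lambda>k c d. F_inv (m l) (lam l k) (?F ! c) (?F ! d)) * transpose_mat (S_op Nx m N l)"
    unfolding F_relax_def by simp
  also have "\<dots> = mode_mat (N l) (N l) (\<lambda>k i j. \<Sum>d<?n.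
      (\<Sum>c<?n. (if i = ?F ! c then 1 else 0) * F_inv (m l) (lam l k) (?F ! c) (?F ! d)) * (if j = ?F ! d then 1 else 0))"
    unfolding St unfolding S by (simp add: mode_mat_mult)
  also have "\<dots> = mode_mat (N l) (N l) (\<lambda>k. F_inv (m l) (lam l k))"
  proof (rule mode_mat_cong)
    fix k i j assume ij: "i < N l" "j < N l"
    let ?h = "F_inv (m l) (lam l k)"
    have "(\<Sum>c<?n. (if i = ?F ! c then 1 else 0) * ?h (?F ! c) d) = ?h i d" for d
    proof -
      have "(\<Sum>c<?n. (if i = ?F ! c then 1 else 0) * ?h (?F ! c) d)
          = (\<Sum>e<N l. if m l dvd e then 0 else (if i = e then 1 else 0) * ?h e d)"
        by (rule sum_F_points)
      also have "\<dots> = (\<Sum>e<N l. if e = i then ?h i d else 0)"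
        by (intro sum.cong refl) (auto simp: F_inv_def)
      finally show ?thesis using ij by simp
    qed
    then have "(\<Sum>d<?n. (\<Sum>c<?n. (if i = ?F ! c then 1 else 0) * ?h (?F ! c) (?F ! d)) * (if j = ?F ! d then 1 else 0))
        = (\<Sum>d<?n. ?h i (?F ! d) * (if j = ?F ! d then 1 else 0))" by simp
    also have "\<dots> = (\<Sum>e<N l. if m l dvd e then 0 else ?h i e * (if j = e then 1 else 0))"
      by (rule sum_F_points)
    also have "\<dots> = (\<Sum>e<N l. if e = j then ?h i j else 0)"
      by (intro sum.cong refl) (auto simp: F_inv_def)
    finally show "(\<Sum>d<?n. (\<Sum>c<?n. (if i = ?F ! c then 1 else 0) * ?h (?F ! c) (?F ! d)) * (if j = ?F ! d then 1 else 0))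
      = ?h i j" using ij by simp
  qed
  finally show ?thesis .
qed

lemma coarse_correction_mode:
  assumes l: "l < 3"
  shows "P_op Nx m N \<Phi> l * mode_mat (N (Suc l)) (N (Suc l)) X * R_op Nx m N \<Phi> l =
    mode_mat (N l) (N l) (\<lambda>k i j. lam l k ^ (i mod m l) * X k (i div m l) (cdiv j (m l))
      * lam l k ^ (m l * cdiv j (m l) - j))"
  unfolding P_op_mode[OF l] R_op_mode[OF l] mode_mat_mult
  by (rule mode_mat_cong) (simp add: N_bound[OF l] if_distrib[of "\<lambda>x. x * _"] if_distrib[of "\<lambda>x. _ * x"] cong: if_cong)

lemma two_level_mode:
  assumes l: "l < 3" and X: "\<And>k. lower_tri (X k)"
  shows "F_relax Nx m N \<Phi> l + P_op Nx m N \<Phi> l * mode_mat (N (Suc l)) (N (Suc l)) X * R_op Nx m N \<Phi> l =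
    mode_mat (N l) (N l) (\<lambda>k. cyc_inv (m l) (lam l k) (X k))"
  unfolding coarse_correction_mode[OF l] F_relax_mode[OF l] mode_mat_add
    F_inv_plus_coarse[OF m_pos[OF l] X] ..

text \<open>Interpolated vectors follow the time stepping inside each interval, so the rows of
  F-points vanish. The point before a C-point closes the preceding interval at offset
  \<open>m 0 - 1\<close>; one more step gives the power \<open>m 0\<close>.\<close>

lemma A0_P0_mode:
  "A_op Nx N \<Phi> 0 * P_op Nx m N \<Phi> 0 = mode_mat (N 0) (N 1)
    (\<lambda>k r j. if m 0 dvd r then bidiag (lam 0 k ^ m 0) (r div m 0) j else 0)"
proof -
  have m0: "1 \<le> m 0" using m_pos[of 0] by simp
  have "(\<Sum>l<N 0. bidiag x r l * (if j = l div m 0 then x ^ (l mod m 0) else 0))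
      = (if m 0 dvd r then bidiag (x ^ m 0) (r div m 0) j else 0)" if r: "r < N 0" for x r j
  proof (cases "m 0 dvd r")
    case True
    then obtain c where c: "r = m 0 * c" by blast
    show ?thesis
    proof (cases c)
      case 0
      then show ?thesis using c r unfolding sum_bidiag_left[OF r] by (auto simp: bidiag_def)
    next
      case (Suc c')
      have r1: "r - 1 = m 0 * c' + (m 0 - 1)" using c Suc m0 by simp
      have gap: "(m 0 * c' + t) div m 0 = c'" "(m 0 * c' + t) mod m 0 = t" if "t < m 0" for t
        using that by simp_all
      have "m 0 - 1 < m 0" using m0 by simp
      then have "(r - 1) div m 0 = c'" "(r - 1) mod m 0 = m 0 - 1"
        unfolding r1 by (rule gap)+
      moreover have "x * x ^ (m 0 - 1) = x ^ m 0" using m0 by (simp flip: power_Suc)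
      ultimately show ?thesis using m0 c Suc unfolding sum_bidiag_left[OF r] by (auto simp: bidiag_def)
    qed
  next
    case False
    obtain c s where c: "r = Suc (m 0 * c + s)" "Suc s < m 0" "c = r div m 0"
      using False m0 by (rule not_dvdE)
    have "r = m 0 * c + Suc s" using c by simp
    then have "r mod m 0 = Suc s" using c(2) by simp
    moreover have "(m 0 * c + s) div m 0 = c" "(m 0 * c + s) mod m 0 = s" using c(2) by simp_all
    then have "(r - 1) div m 0 = r div m 0" "(r - 1) mod m 0 = s"
      unfolding c(3)[symmetric] using c(1) by simp_all
    ultimately show ?thesis using False c(1) unfolding sum_bidiag_left[OF r] by auto
  qed
  moreover have "P_op Nx m N \<Phi> 0 = mode_mat (N 0) (N 1)
      (\<lambda>k i j. if j = i div m 0 then lam 0 k ^ (i mod m 0) else 0)"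
    using P_op_mode[of 0] by simp
  ultimately show ?thesis by (simp only: A_op_mode[of 0, simplified] mode_mat_mult cong: mode_mat_cong)
qed

text \<open>By \<open>A0_P0_mode\<close> only C-rows matter, and on these restriction acts as the
  identity.\<close>

lemma R0_A0_P0_mode:
  "R_op Nx m N \<Phi> 0 * A_op Nx N \<Phi> 0 * P_op Nx m N \<Phi> 0 = mode_mat (N 1) (N 1) (\<lambda>k. bidiag (lam 0 k ^ m 0))"
proof -
  have m0: "1 \<le> m 0" using m_pos[of 0] by simp
  have R: "R_op Nx m N \<Phi> 0 = mode_mat (N 1) (N 0)
      (\<lambda>k j c. if j = cdiv c (m 0) then lam 0 k ^ (m 0 * cdiv c (m 0) - c) else 0)"
    using R_op_mode[of 0] by simp
  have "R_op Nx m N \<Phi> 0 * A_op Nx N \<Phi> 0 * P_op Nx m N \<Phi> 0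
      = R_op Nx m N \<Phi> 0 * (A_op Nx N \<Phi> 0 * P_op Nx m N \<Phi> 0)"
    unfolding R A_op_mode[of 0, simplified] P_op_mode[of 0, simplified]
    by (rule assoc_mult_mat) (rule mode_mat_carrier)+
  also have "\<dots> = mode_mat (N 1) (N 1) (\<lambda>k. bidiag (lam 0 k ^ m 0))"
    unfolding A0_P0_mode R mode_mat_mult
  proof (rule mode_mat_cong)
    fix k i j assume ij: "i < N 1" "j < N 1"
    have "(\<Sum>c<N 0. (if i = cdiv c (m 0) then lam 0 k ^ (m 0 * cdiv c (m 0) - c) else 0)
          * (if m 0 dvd c then bidiag (lam 0 k ^ m 0) (c div m 0) j else 0))
        = (\<Sum>c<N 0. if c = m 0 * i then bidiag (lam 0 k ^ m 0) i j else 0)"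
      using m0 by (intro sum.cong refl) (auto simp del: One_nat_def elim!: dvdE)
    then show "(\<Sum>c<N 0. (if i = cdiv c (m 0) then lam 0 k ^ (m 0 * cdiv c (m 0) - c) else 0)
          * (if m 0 dvd c then bidiag (lam 0 k ^ m 0) (c div m 0) j else 0))
        = bidiag (lam 0 k ^ m 0) i j"
      using C_point_bound[of 0 i] ij by simp
  qed
  finally show ?thesis .
qed

end

text \<open>Turns the flat sum in \<open>E_coarse\<close> into a two-level cycle nested in another
  one, so that \<open>two_level_mode\<close> can be applied on level 2 and then on level 1.\<close>

lemma nested_correction:
  fixes P1 P2 A R2 R1 F1 F2 :: "'a::comm_ring_1 mat"
  assumes c: "P1 \<in> carrier_mat n1 n2" "P2 \<in> carrier_mat n2 n3" "A \<in> carrier_mat n3 n3"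
    "R2 \<in> carrier_mat n3 n2" "R1 \<in> carrier_mat n2 n1" "F1 \<in> carrier_mat n1 n1" "F2 \<in> carrier_mat n2 n2"
  shows "P1 * P2 * A * R2 * R1 + F1 + P1 * F2 * R1 = F1 + P1 * (F2 + P2 * A * R2) * R1"
proof -
  have s: "P2 * A \<in> carrier_mat n2 n3" "P2 * A * R2 \<in> carrier_mat n2 n2" "P1 * F2 \<in> carrier_mat n1 n2"
    "P1 * (P2 * A * R2) \<in> carrier_mat n1 n2" "P1 * F2 * R1 \<in> carrier_mat n1 n1"
    "P1 * (P2 * A * R2) * R1 \<in> carrier_mat n1 n1"
    using c by auto
  have "P1 * (P2 * A * R2) = P1 * (P2 * A) * R2" using assoc_mult_mat[OF c(1) s(1) c(4)] by simp
  also have "\<dots> = P1 * P2 * A * R2" using assoc_mult_mat[OF c(1-3)] by simp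
  finally have e: "P1 * P2 * A * R2 * R1 = P1 * (P2 * A * R2) * R1" by simp
  have "P1 * (F2 + P2 * A * R2) * R1 = P1 * F2 * R1 + P1 * (P2 * A * R2) * R1"
    using mult_add_distrib_mat[OF c(1) c(7) s(2)] add_mult_distrib_mat[OF s(3,4) c(5)] by simp
  then show ?thesis unfolding e
    using comm_add_mat[OF s(5,6)] comm_add_mat[OF c(6) s(6)] assoc_add_mat[OF c(6) s(6) s(5)] by simp
qed

section \<open>The error propagator and the residual\<close>

text \<open>Symmetry about the antidiagonal of the square with indices 0 to \<open>K\<close>;
  \<open>K\<close> is the last index, not the size.\<close>

definition persymmetric :: "nat \<Rightarrow> (nat \<Rightarrow> nat \<Rightarrow> complex) \<Rightarrow> bool" where
  "persymmetric K X \<longleftrightarrow> (\<forall>i\<le>K. \<forall>j\<le>K. X (K - j) (K - i) = X i j)"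

lemma persymmetric_seq_inv: "persymmetric K (seq_inv x)"
  by (auto simp: persymmetric_def seq_inv_def)

text \<open>Reflection turns rounding down into rounding up: quotient and remainder of
  \<open>m * K - j\<close> come from the next C-point after \<open>j\<close> and the distance to it,
  and conversely for \<open>i\<close>. The two outer powers of \<open>x\<close> thus change
  places.\<close>

lemma persymmetric_cyc_inv:
  assumes m: "1 \<le> m" and X: "persymmetric K X"
  shows "persymmetric (m * K) (cyc_inv m x X)"
proof -
  have "cyc_inv m x X (m * K - j) (m * K - i) = cyc_inv m x X i j" if ij: "i \<le> m * K" "j \<le> m * K" for i j
  proof -
    have J: "cdiv j m \<le> K" using ij cdiv_le_iff[OF m] by blast
    have I: "i div m \<le> K" using div_le_mono[OF ij(1), of m] m by simp
    have mJ: "m * cdiv j m \<le> m * K" "m * (i div m) \<le> m * K" using I J by simp_all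
    have dj: "(m * K - j) div m = K - cdiv j m" "(m * K - j) mod m = m * cdiv j m - j"
    proof -
      have e: "m * K - j = m * (K - cdiv j m) + (m * cdiv j m - j)"
        using mJ le_mult_cdiv[OF m, of j] by (simp add: diff_mult_distrib2)
      show "(m * K - j) div m = K - cdiv j m" "(m * K - j) mod m = m * cdiv j m - j"
        unfolding e using cdiv_gap[OF m, of j] by simp_all
    qed
    have im: "m * (i div m) + i mod m = i" "i mod m < m" using m by simp_all
    have di: "cdiv (m * K - i) m = K - i div m"
    proof (rule antisym)
      have "m * (i div m) \<le> i" by simp
      then have "m * K - i \<le> m * (K - i div m)" unfolding diff_mult_distrib2 by (rule diff_le_mono2)
      then show "cdiv (m * K - i) m \<le> K - i div m" using cdiv_le_iff[OF m] by blast
      have "m * K - i \<le> m * cdiv (m * K - i) m" by (rule le_mult_cdiv[OF m])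
      then have "m * K < m * (cdiv (m * K - i) m + i div m + 1)"
        unfolding distrib_left mult_1_right using im ij by linarith
      then have "K < cdiv (m * K - i) m + i div m + 1" by (simp only: nat_mult_less_cancel_disj)
      then show "K - i div m \<le> cdiv (m * K - i) m" by simp
    qed
    have gap: "m * (K - i div m) - (m * K - i) = i mod m"
      unfolding diff_mult_distrib2 using im mJ ij by linarith
    have "m * K - i \<le> m * (K - cdiv j m) \<longleftrightarrow> m * cdiv j m \<le> i"
      unfolding diff_mult_distrib2 using mJ ij by linarith
    also have "\<dots> \<longleftrightarrow> cdiv j m \<le> i div m" using m by (simp add: less_eq_div_iff_mult_less_eq mult.commute)
    finally have c: "m * K - i \<le> m * (K - cdiv j m) \<longleftrightarrow> j \<le> m * (i div m)"
      using cdiv_le_iff[OF m] by simp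
    have "X (K - cdiv j m) (K - i div m) = X (i div m) (cdiv j m)"
      using X I J by (simp add: persymmetric_def)
    then show ?thesis unfolding cyc_inv_def dj di gap c using ij
      by (auto simp: mult.commute mult.left_commute)
  qed
  then show ?thesis by (simp add: persymmetric_def)
qed

text \<open>On and above the diagonal the terms cancel or vanish, so algebra with
  \<open>err_prop\<close> can do without its case distinction.\<close>

lemma err_prop_full:
  assumes "lower_tri X" "unit_diag X"
  shows "err_prop a X i j = (if i = j then 1 else 0) - X i j + a * X i (Suc j)"
  using assms by (auto simp: err_prop_def lower_tri_def unit_diag_def not_less)

text \<open>With \<open>A\<close> the bidiagonal matrix this is
  \<open>A (I - X A) = (I - A X) A\<close>, where persymmetry of \<open>X\<close> and
  \<open>A\<close> identifies \<open>I - A X\<close> with the reflected error propagator.\<close>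

lemma bidiag_err_prop_flip:
  assumes X: "lower_tri X" "unit_diag X" "persymmetric K X" and ij: "i \<le> K" "j \<le> K"
  shows "(\<Sum>l<Suc K. bidiag a i l * err_prop a X l j)
    = (\<Sum>l<Suc K. err_prop a X (K - l) (K - i) * bidiag a l j)"
proof -
  \<comment> \<open>The reflected entry is the entry of \<open>I - A X\<close> at
    \<open>(i, j)\<close>.\<close>
  have b: "err_prop a X (K - j) (K - i)
      = (if i = j then 1 else 0) - X i j + (if i = 0 then 0 else a * X (i - 1) j)" if "j \<le> K" for j
  proof -
    have "X (K - j) (K - i) = X i j" using X(3) ij that by (simp add: persymmetric_def)
    moreover have "X (K - j) (Suc (K - i)) = (if i = 0 then 0 else X (i - 1) j)"
    proof (cases "i = 0")
      case True
      then show ?thesis using X(1) by (simp add: lower_tri_def)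
    next
      case False
      then have "Suc (K - i) = K - (i - 1)" using ij by simp
      moreover have "X (K - j) (K - (i - 1)) = X (i - 1) j"
        using X(3) ij that unfolding persymmetric_def by (meson diff_le_self le_trans)
      ultimately show ?thesis using False by simp
    qed
    moreover have "K - j = K - i \<longleftrightarrow> i = j" using ij that by auto
    ultimately show ?thesis unfolding err_prop_full[OF X(1,2)] by simp
  qed
  \<comment> \<open>For \<open>j = K\<close> the left side refers to column \<open>Suc K\<close>,
    which the right side does not contain.\<close>
  have K0: "X l (Suc K) = 0" if "l \<le> K" for l using X(1) that by (simp add: lower_tri_def)
  have "i < Suc K" "j < Suc K" using ij by simp_all
  have L: "(\<Sum>l<Suc K. bidiag a i l * err_prop a X l j) =
      (if i = j then 1 else 0) - X i j + a * X i (Suc j)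
      - (if i = 0 then 0 else a * ((if i - 1 = j then 1 else 0) - X (i - 1) j + a * X (i - 1) (Suc j)))"
    unfolding sum_bidiag_left[OF \<open>i < Suc K\<close>] err_prop_full[OF X(1,2)] ..
  have R: "(\<Sum>l<Suc K. err_prop a X (K - l) (K - i) * bidiag a l j) =
      (if i = j then 1 else 0) - X i j + (if i = 0 then 0 else a * X (i - 1) j)
      - (if j < K then a * ((if i = Suc j then 1 else 0) - X i (Suc j)
          + (if i = 0 then 0 else a * X (i - 1) (Suc j))) else 0)"
    unfolding sum_bidiag_right[OF \<open>j < Suc K\<close>] using b[OF ij(2)] b[of "Suc j"] by (cases "j < K") simp_all
  show ?thesis
  proof (cases "j = K")
    case True
    then show ?thesis unfolding L R using K0[OF ij(1)] K0[of "i - 1"] ij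
      by (cases i) (simp_all add: algebra_simps)
  next
    case False
    then show ?thesis unfolding L R using ij by (cases i) (simp_all add: algebra_simps)
  qed
qed

section \<open>The complete cycle mode by mode, and the iteration of the residuals\<close>

context time_grid
begin

definition cycle :: "nat \<Rightarrow> nat \<Rightarrow> nat \<Rightarrow> complex" where
  "cycle k = cyc_inv (m 1) (lam 1 k) (cyc_inv (m 2) (lam 2 k) (seq_inv (lam 3 k)))"

definition propagator :: "nat \<Rightarrow> nat \<Rightarrow> nat \<Rightarrow> complex" where
  "propagator k = err_prop (lam 0 k ^ m 0) (cycle k)"

lemma cycle_props:
  "lower_tri (cycle k)" "unit_diag (cycle k)" "persymmetric (N 1 - 1) (cycle k)"
proof -
  have m: "1 \<le> m 1" "1 \<le> m 2" by (simp_all only: m_pos)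
  show "lower_tri (cycle k)" "unit_diag (cycle k)"
    unfolding cycle_def using m
    by (auto intro!: lower_tri_cyc_inv unit_diag_cyc_inv unit_diag_seq_inv simp del: One_nat_def)
  have "N 1 - 1 = m 1 * (m 2 * (N 3 - 1))"
    using N_eq[of 1] N_eq[of 2] by (simp add: numeral_2_eq_2 numeral_3_eq_3)
  then show "persymmetric (N 1 - 1) (cycle k)"
    unfolding cycle_def using m
    by (simp only:) (intro persymmetric_cyc_inv persymmetric_seq_inv)
qed

lemma E_coarse_mode: "E_coarse Nx m N \<Phi> = mode_mat (N 1) (N 1) propagator"
proof -
  let ?X2 = "\<lambda>k. cyc_inv (m 2) (lam 2 k) (seq_inv (lam 3 k))"
  have l: "(1::nat) < 3" "(2::nat) < 3" and S: "Suc 1 = 2" "Suc 2 = (3::nat)" by simp_all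
  have A3: "minv (A_op Nx N \<Phi> 3) = mode_mat (N 3) (N 3) (\<lambda>k. seq_inv (lam 3 k))"
    unfolding A_op_mode[OF order_refl] by (intro minv_mode_mat bidiag_seq_inv)
  have X2: "lower_tri (?X2 k)" for k by (intro lower_tri_cyc_inv m_pos l)
  have c: "P_op Nx m N \<Phi> 1 \<in> carrier_mat (N 1 * Nx) (N 2 * Nx)"
    "P_op Nx m N \<Phi> 2 \<in> carrier_mat (N 2 * Nx) (N 3 * Nx)"
    "R_op Nx m N \<Phi> 2 \<in> carrier_mat (N 3 * Nx) (N 2 * Nx)"
    "R_op Nx m N \<Phi> 1 \<in> carrier_mat (N 2 * Nx) (N 1 * Nx)"
    "F_relax Nx m N \<Phi> 1 \<in> carrier_mat (N 1 * Nx) (N 1 * Nx)"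
    "F_relax Nx m N \<Phi> 2 \<in> carrier_mat (N 2 * Nx) (N 2 * Nx)"
    unfolding P_op_mode[OF l(1)] P_op_mode[OF l(2)] R_op_mode[OF l(1)] R_op_mode[OF l(2)]
      F_relax_mode[OF l(1)] F_relax_mode[OF l(2)] S by (rule mode_mat_carrier)+
  have "P_op Nx m N \<Phi> 1 * P_op Nx m N \<Phi> 2 * minv (A_op Nx N \<Phi> 3) * R_op Nx m N \<Phi> 2 * R_op Nx m N \<Phi> 1
      + F_relax Nx m N \<Phi> 1 + P_op Nx m N \<Phi> 1 * F_relax Nx m N \<Phi> 2 * R_op Nx m N \<Phi> 1
    = F_relax Nx m N \<Phi> 1 + P_op Nx m N \<Phi> 1 * (F_relax Nx m N \<Phi> 2
      + P_op Nx m N \<Phi> 2 * mode_mat (N 3) (N 3) (\<lambda>k. seq_inv (lam 3 k)) * R_op Nx m N \<Phi> 2) * R_op Nx m N \<Phi> 1"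
    unfolding A3 by (rule nested_correction[OF c(1,2) mode_mat_carrier c(3-6)])
  also have "\<dots> = mode_mat (N 1) (N 1) cycle"
    using two_level_mode[OF l(2), of "\<lambda>k. seq_inv (lam 3 k)"] two_level_mode[OF l(1), of ?X2] X2
    unfolding S by (simp only: lower_tri_seq_inv cycle_def[abs_def])
  finally have "E_coarse Nx m N \<Phi> = mode_mat (N 1) (N 1) (\<lambda>k i j. (if i = j then 1 else 0)
      - (\<Sum>l<N 1. cycle k i l * bidiag (lam 0 k ^ m 0) l j))"
    unfolding E_coarse_def R0_A0_P0_mode mode_mat_one by (simp only: mode_mat_mult mode_mat_diff)
  also have "\<dots> = mode_mat (N 1) (N 1) propagator"
  proof (rule mode_mat_cong)
    fix k i j assume "i < N 1" and j: "j < N 1"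
    \<comment> \<open>In the last column the sum over the grid has no term for \<open>Suc j\<close>,
      while \<open>err_prop\<close> still refers to it; triangularity makes that entry zero.\<close>
    then have "cycle k i (Suc j) = 0" if "\<not> Suc j < N 1"
      using cycle_props(1) that by (simp add: lower_tri_def)
    then show "(if i = j then 1 else 0) - (\<Sum>l<N 1. cycle k i l * bidiag (lam 0 k ^ m 0) l j) = propagator k i j"
      unfolding sum_bidiag_right[OF j] propagator_def err_prop_full[OF cycle_props(1,2)] by auto
  qed
  finally show ?thesis .
qed

lemma P0_mode: "P_op Nx m N \<Phi> 0 = mode_mat (N 0) (N 1)
    (\<lambda>k i j. if j = i div m 0 then lam 0 k ^ (i mod m 0) else 0)"
  using P_op_mode[of 0] by simp

lemma fine_carriers:
  "A_op Nx N \<Phi> 0 \<in> carrier_mat (N 0 * Nx) (N 0 * Nx)"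
  "P_op Nx m N \<Phi> 0 \<in> carrier_mat (N 0 * Nx) (N 1 * Nx)"
  "E_coarse Nx m N \<Phi> \<in> carrier_mat (N 1 * Nx) (N 1 * Nx)"
  "RI0_op Nx m N \<in> carrier_mat (N 1 * Nx) (N 0 * Nx)"
  using A_op_mode[of 0] P0_mode E_coarse_mode RI0_op_mode by simp_all

text \<open>Injection undoes interpolation because offset 0 of every interval is copied unchanged.
  This is why everything in the range of \<open>E_fine\<close> is F-relaxed.\<close>

lemma RI0_P0: "RI0_op Nx m N * P_op Nx m N \<Phi> 0 = 1\<^sub>m (N 1 * Nx)"
  unfolding RI0_op_mode P0_mode mode_mat_mult mode_mat_one
proof (rule mode_mat_cong)
  fix k i j assume ij: "i < N 1" "j < N 1"
  have "(\<Sum>l<N 0. (if l = m 0 * i then 1 else 0) * (if j = l div m 0 then lam 0 k ^ (l mod m 0) else 0))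
      = (\<Sum>l<N 0. if l = m 0 * i then (if i = j then 1 else 0) else 0)"
    using m_pos[of 0] by (intro sum.cong refl) auto
  then show "(\<Sum>l<N 0. (if l = m 0 * i then 1 else 0) * (if j = l div m 0 then lam 0 k ^ (l mod m 0) else 0))
      = (if i = j then 1 else 0)"
    using C_point_bound[of 0 i] ij by simp
qed

text \<open>
  The propagator reflected at the antidiagonal and embedded at the C-points of the fine level.
\<close>

definition residual_propagator :: "nat \<Rightarrow> nat \<Rightarrow> nat \<Rightarrow> complex" where
  "residual_propagator k r c = (if m 0 dvd r \<and> m 0 dvd c
     then propagator k (N 1 - 1 - c div m 0) (N 1 - 1 - r div m 0) else 0)"

text \<open>\<open>bidiag_err_prop_flip\<close> carried to the fine grid: \<open>A0_P0_mode\<close>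
  leaves only C-rows, so sums over fine points collapse to sums over level 1.\<close>

lemma A0_P0_E_coarse:
  "A_op Nx N \<Phi> 0 * P_op Nx m N \<Phi> 0 * E_coarse Nx m N \<Phi>
    = mode_mat (N 0) (N 0) residual_propagator * (A_op Nx N \<Phi> 0 * P_op Nx m N \<Phi> 0)"
  unfolding A0_P0_mode E_coarse_mode mode_mat_mult
proof (rule mode_mat_cong)
  fix k r j assume rj: "r < N 0" "j < N 1"
  let ?a = "lam 0 k ^ m 0" and ?K = "N 1 - 1"
  have N1: "N 1 = Suc ?K" using N_pos[of 1] by simp
  have m0: "1 \<le> m 0" using m_pos[of 0] by simp
  have N0: "N 0 = m 0 * (N 1 - 1) + 1" using N_eq[of 0] by simp
  show "(\<Sum>l<N 1. (if m 0 dvd r then bidiag ?a (r div m 0) l else 0) * propagator k l j)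
    = (\<Sum>l<N 0. residual_propagator k r l * (if m 0 dvd l then bidiag ?a (l div m 0) j else 0))"
  proof (cases "m 0 dvd r")
    case True
    have r: "r div m 0 \<le> ?K" "j \<le> ?K" using N_bound(1)[of 0 r] rj by simp_all
    have "(\<Sum>l<N 0. residual_propagator k r l * (if m 0 dvd l then bidiag ?a (l div m 0) j else 0))
        = (\<Sum>l<m 0 * (N 1 - 1) + 1. if m 0 dvd l
            then propagator k (?K - l div m 0) (?K - r div m 0) * bidiag ?a (l div m 0) j else 0)"
      unfolding N0[symmetric] by (intro sum.cong refl) (simp add: residual_propagator_def True)
    also have "\<dots> = (\<Sum>l<N 1. propagator k (?K - l) (?K - r div m 0) * bidiag ?a l j)"
      using m0 N_pos[of 1] by (intro sum_C_points[where \<phi> = "\<lambda>l. propagator k (?K - l) (?K - r div m 0) * bidiag ?a l j"]) auto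
    also have "\<dots> = (\<Sum>l<N 1. bidiag ?a (r div m 0) l * propagator k l j)"
      using bidiag_err_prop_flip[OF cycle_props[of k] r, where a = ?a] unfolding propagator_def N1[symmetric] by simp
    finally show ?thesis using True by simp
  qed (simp add: residual_propagator_def)
qed

text \<open>The reflection interchanges rows and columns, so the column bound \<open>C\<close>
  controls row sums and \<open>R\<close> controls column sums. At F-points both sums are zero, hence
  the bounds must be nonnegative.\<close>

lemma residual_propagator_sums:
  assumes C: "\<And>d. d < N 1 \<Longrightarrow> (\<Sum>i<N 1. cmod (propagator k i d)) \<le> C"
    and R: "\<And>d. d < N 1 \<Longrightarrow> (\<Sum>j<N 1. cmod (propagator k d j)) \<le> R"
    and 0: "0 \<le> C" "0 \<le> R" and r: "r < N 0"
  shows "(\<Sum>c<N 0. cmod (residual_propagator k r c)) \<le> C"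
    "(\<Sum>c<N 0. cmod (residual_propagator k c r)) \<le> R"
proof -
  let ?K = "N 1 - 1"
  have m0: "1 \<le> m 0" "1 \<le> N 1" using m_pos[of 0] N_pos[of 1] by simp_all
  have N0: "N 0 = m 0 * (N 1 - 1) + 1" using N_eq[of 0] by simp
  have d: "?K - r div m 0 < N 1" using m0 by simp
  have flip: "(\<Sum>l<N 1. \<phi> (?K - l)) = (\<Sum>l<N 1. \<phi> l)" for \<phi> :: "nat \<Rightarrow> real"
    using sum.nat_diff_reindex[of \<phi> "N 1"] by simp
  show "(\<Sum>c<N 0. cmod (residual_propagator k r c)) \<le> C"
  proof (cases "m 0 dvd r")
    case True
    have "(\<Sum>c<N 0. cmod (residual_propagator k r c))
        = (\<Sum>c<m 0 * (N 1 - 1) + 1. if m 0 dvd c then cmod (propagator k (?K - c div m 0) (?K - r div m 0)) else 0)"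
      unfolding N0[symmetric] by (intro sum.cong refl) (simp add: residual_propagator_def True)
    also have "\<dots> = (\<Sum>l<N 1. cmod (propagator k (?K - l) (?K - r div m 0)))"
      using m0 by (intro sum_C_points[where \<phi> = "\<lambda>l. cmod (propagator k (?K - l) (?K - r div m 0))"])
    also have "\<dots> = (\<Sum>l<N 1. cmod (propagator k l (?K - r div m 0)))"
      by (rule flip[where \<phi> = "\<lambda>l. cmod (propagator k l (?K - r div m 0))"])
    finally show ?thesis using C[OF d] by simp
  qed (simp add: residual_propagator_def 0)
  show "(\<Sum>c<N 0. cmod (residual_propagator k c r)) \<le> R"
  proof (cases "m 0 dvd r")
    case True
    have "(\<Sum>c<N 0. cmod (residual_propagator k c r))
        = (\<Sum>c<m 0 * (N 1 - 1) + 1. if m 0 dvd c then cmod (propagator k (?K - r div m 0) (?K - c div m 0)) else 0)"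
      unfolding N0[symmetric] by (intro sum.cong refl) (simp add: residual_propagator_def True)
    also have "\<dots> = (\<Sum>l<N 1. cmod (propagator k (?K - r div m 0) (?K - l)))"
      using m0 by (intro sum_C_points[where \<phi> = "\<lambda>l. cmod (propagator k (?K - r div m 0) (?K - l))"])
    also have "\<dots> = (\<Sum>l<N 1. cmod (propagator k (?K - r div m 0) l))"
      by (rule flip[where \<phi> = "\<lambda>l. cmod (propagator k (?K - r div m 0) l)"])
    finally show ?thesis using R[OF d] by simp
  qed (simp add: residual_propagator_def 0)
qed

lemma E_fine_vec:
  assumes "e \<in> carrier_vec (N 0 * Nx)"
  shows "E_fine Nx m N \<Phi> *\<^sub>v e = P_op Nx m N \<Phi> 0 *\<^sub>v (E_coarse Nx m N \<Phi> *\<^sub>v (RI0_op Nx m N *\<^sub>v e))"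
proof -
  note c = fine_carriers
  have "P_op Nx m N \<Phi> 0 * E_coarse Nx m N \<Phi> \<in> carrier_mat (N 0 * Nx) (N 1 * Nx)"
    and v: "RI0_op Nx m N *\<^sub>v e \<in> carrier_vec (N 1 * Nx)" using c assms by auto
  then show ?thesis
    unfolding E_fine_def using assoc_mult_mat_vec[OF _ c(4) assms] assoc_mult_mat_vec[OF c(2,3) v] by simp
qed

lemma E_fine_F_relaxed:
  assumes "e \<in> carrier_vec (N 0 * Nx)"
  shows "F_relaxed Nx m N \<Phi> (E_fine Nx m N \<Phi> *\<^sub>v e)"
proof -
  note c = fine_carriers
  have v: "E_coarse Nx m N \<Phi> *\<^sub>v (RI0_op Nx m N *\<^sub>v e) \<in> carrier_vec (N 1 * Nx)" using c assms by auto
  show ?thesis unfolding F_relaxed_def E_fine_vec[OF assms]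
    using assoc_mult_mat_vec[OF c(4,2) v] v by (simp add: RI0_P0)
qed

text \<open>An F-relaxed error is interpolated from its C-points, so its residual lies in the range
  of \<open>A P\<close> on level 0, where \<open>A0_P0_E_coarse\<close> applies.\<close>

lemma residual_step:
  assumes e: "e \<in> carrier_vec (N 0 * Nx)" and F: "F_relaxed Nx m N \<Phi> e"
  shows "A_op Nx N \<Phi> 0 *\<^sub>v (E_fine Nx m N \<Phi> *\<^sub>v e)
    = mode_mat (N 0) (N 0) residual_propagator *\<^sub>v (A_op Nx N \<Phi> 0 *\<^sub>v e)"
proof -
  note c = fine_carriers
  let ?x = "RI0_op Nx m N *\<^sub>v e" and ?Q = "mode_mat (N 0) (N 0) residual_propagator"
  have x: "?x \<in> carrier_vec (N 1 * Nx)" using c e by auto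
  have Ex: "E_coarse Nx m N \<Phi> *\<^sub>v ?x \<in> carrier_vec (N 1 * Nx)" using c x by auto
  have AP: "A_op Nx N \<Phi> 0 * P_op Nx m N \<Phi> 0 \<in> carrier_mat (N 0 * Nx) (N 1 * Nx)" using c by auto
  have "A_op Nx N \<Phi> 0 *\<^sub>v (E_fine Nx m N \<Phi> *\<^sub>v e)
      = A_op Nx N \<Phi> 0 * P_op Nx m N \<Phi> 0 * E_coarse Nx m N \<Phi> *\<^sub>v ?x"
    unfolding E_fine_vec[OF e] assoc_mult_mat_vec[OF AP c(3) x] assoc_mult_mat_vec[OF c(1,2) Ex] ..
  also have "\<dots> = ?Q *\<^sub>v (A_op Nx N \<Phi> 0 *\<^sub>v (P_op Nx m N \<Phi> 0 *\<^sub>v ?x))"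
    unfolding A0_P0_E_coarse assoc_mult_mat_vec[OF mode_mat_carrier AP x] assoc_mult_mat_vec[OF c(1,2) x] ..
  also have "P_op Nx m N \<Phi> 0 *\<^sub>v ?x = e" using F by (simp add: F_relaxed_def)
  finally show ?thesis .
qed

lemma err_carrier:
  assumes "e0 \<in> carrier_vec (N 0 * Nx)"
  shows "err Nx m N \<Phi> e0 i \<in> carrier_vec (N 0 * Nx)"
proof (induction i)
  case (Suc i)
  then show ?case using fine_carriers by (auto simp: err_def E_fine_vec)
qed (use assms in \<open>simp add: err_def\<close>)

lemma conv_factor_le:
  assumes e0: "e0 \<in> carrier_vec (N 0 * Nx)"
    and C: "\<And>k d. k < Nx \<Longrightarrow> d < N 1 \<Longrightarrow> (\<Sum>i<N 1. cmod (propagator k i d)) \<le> C"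
    and R: "\<And>k d. k < Nx \<Longrightarrow> d < N 1 \<Longrightarrow> (\<Sum>j<N 1. cmod (propagator k d j)) \<le> R"
    and 0: "0 \<le> C" "0 \<le> R"
  shows "conv_factor Nx m N \<Phi> e0 \<le> ereal (sqrt (C * R))"
  unfolding conv_factor_def
proof (rule SUP_least)
  fix i :: nat assume i: "i \<in> {i. i \<ge> 1 \<or> F_relaxed Nx m N \<Phi> e0}"
  let ?e = "err Nx m N \<Phi> e0"
  have e: "?e i \<in> carrier_vec (N 0 * Nx)" for i by (rule err_carrier[OF e0])
  have step: "?e (Suc i) = E_fine Nx m N \<Phi> *\<^sub>v ?e i" for i by (simp add: err_def)
  have F: "F_relaxed Nx m N \<Phi> (?e i)"
  proof (cases i)
    case 0
    then show ?thesis using i by (simp add: err_def)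
  next
    case (Suc i')
    then show ?thesis using E_fine_F_relaxed[OF e[of i']] Suc by (simp add: step)
  qed
  have "norm_2 (res Nx m N \<Phi> e0 (Suc i)) \<le> sqrt (C * R) * norm_2 (res Nx m N \<Phi> e0 i)"
    unfolding res_def step residual_step[OF e F]
    using fine_carriers(1) e[of i] residual_propagator_sums[OF C R 0]
    by (intro norm_2_mode_mat_le 0) auto
  moreover have "0 \<le> norm_2 v" for v by (simp add: norm_2_def sum_nonneg)
  moreover have "0 \<le> sqrt (C * R)" using 0 by simp
  \<comment> \<open>If the residual has vanished, the quotient is 0 by the convention for division
    by zero and still obeys the bound.\<close>
  ultimately have "norm_2 (res Nx m N \<Phi> e0 (Suc i)) / norm_2 (res Nx m N \<Phi> e0 i) \<le> sqrt (C * R)"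
    by (cases "norm_2 (res Nx m N \<Phi> e0 i) = 0")
      (simp_all add: divide_le_eq order_less_le)
  then show "ereal (norm_2 (res Nx m N \<Phi> e0 (Suc i)) / norm_2 (res Nx m N \<Phi> e0 i)) \<le> ereal (sqrt (C * R))"
    by simp
qed

end

section \<open>Norms in the diagonal basis\<close>

lemma Max_image_eqI:
  fixes f :: "'a \<Rightarrow> 'c::linorder" and g :: "'b \<Rightarrow> 'c"
  assumes fin: "finite A" "finite B" and ne: "A \<noteq> {}" "B \<noteq> {}"
    and AB: "\<And>a. a \<in> A \<Longrightarrow> \<exists>b\<in>B. f a \<le> g b" and BA: "\<And>b. b \<in> B \<Longrightarrow> \<exists>a\<in>A. g b \<le> f a"
  shows "Max (f ` A) = Max (g ` B)"
proof (rule antisym)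
  have "f a \<le> Max (g ` B)" if "a \<in> A" for a
    using AB[OF that] fin by (meson Max_ge finite_imageI imageI order_trans)
  then show "Max (f ` A) \<le> Max (g ` B)" using fin ne by simp
  have "g b \<le> Max (f ` A)" if "b \<in> B" for b
    using BA[OF that] fin by (meson Max_ge finite_imageI imageI order_trans)
  then show "Max (g ` B) \<le> Max (f ` A)" using fin ne by simp
qed

text \<open>In the standard basis mode \<open>k\<close> is component \<open>k\<close> of each block,
  so absolute column and row sums are those of a single scalar matrix. The 1-norm and the maximum
  norm are not unitarily invariant, so they are evaluated here.\<close>

locale unit_basis = mode_basis +
  assumes u_unit: "u p k = (if p = k then 1 else 0)"
begin

lemma flat_index: "k < Nx \<Longrightarrow> d < n \<Longrightarrow> d * Nx + k < n * Nx"
proof -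
  assume "k < Nx" "d < n"
  then have "d * Nx + k < Suc d * Nx" "Suc d * Nx \<le> n * Nx" by (simp, intro mult_le_mono1, simp)
  then show ?thesis by linarith
qed

lemma mode_mat_entry:
  assumes "r < nr * Nx" "c < nc * Nx"
  shows "mode_mat nr nc f $$ (r, c) =
    (if r mod Nx = c mod Nx then f (r mod Nx) (r div Nx) (c div Nx) else 0)"
proof -
  have "mode_mat nr nc f $$ (r, c) =
      (\<Sum>k<Nx. u (r mod Nx) k * f k (r div Nx) (c div Nx) * cnj (u (c mod Nx) k))"
    using assms by (simp add: mode_mat_def)
  also have "\<dots> = (\<Sum>k<Nx. if k = r mod Nx
      then (if r mod Nx = c mod Nx then f (r mod Nx) (r div Nx) (c div Nx) else 0) else 0)"
    by (intro sum.cong refl) (auto simp: u_unit)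
  finally show ?thesis using Nx by simp
qed

lemma col_abs_sum_mode_mat:
  assumes "k < Nx" "d < nc"
  shows "col_abs_sum (mode_mat nr nc f) (d * Nx + k) = (\<Sum>i<nr. cmod (f k i d))"
proof -
  have "col_abs_sum (mode_mat nr nc f) (d * Nx + k)
      = (\<Sum>r<nr * Nx. if r mod Nx = k then cmod (f k (r div Nx) d) else 0)"
    unfolding col_abs_sum_def mode_mat_dim using assms flat_index[OF assms]
    by (intro sum.cong refl) (simp add: mode_mat_entry)
  also have "\<dots> = (\<Sum>i<nr. \<Sum>p<Nx. if p = k then cmod (f k i d) else 0)"
    by (rule sum_flat)
  finally show ?thesis using assms by simp
qed

lemma row_abs_sum_mode_mat:
  assumes "k < Nx" "d < nr"
  shows "row_abs_sum (mode_mat nr nc f) (d * Nx + k) = (\<Sum>j<nc. cmod (f k d j))"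
proof -
  have "row_abs_sum (mode_mat nr nc f) (d * Nx + k)
      = (\<Sum>c<nc * Nx. if c mod Nx = k then cmod (f k d (c div Nx)) else 0)"
    unfolding row_abs_sum_def mode_mat_dim using assms flat_index[OF assms]
    by (intro sum.cong refl) (auto simp: mode_mat_entry)
  also have "\<dots> = (\<Sum>j<nc. \<Sum>p<Nx. if p = k then cmod (f k d j) else 0)"
    by (rule sum_flat)
  finally show ?thesis using assms by simp
qed

text \<open>A flat column index is a pair of time point and mode. \<open>dom\<close> compares time
  points within one mode, which confines the maximum to \<open>D\<close> without mixing
  modes.\<close>

lemma norm_1_mode_mat:
  assumes "D \<subseteq> {..<nc}" "D \<noteq> {}"
    and dom: "\<And>k d. k < Nx \<Longrightarrow> d < nc \<Longrightarrow> \<exists>d'\<in>D. (\<Sum>i<nr. cmod (f k i d)) \<le> (\<Sum>i<nr. cmod (f k i d'))"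
  shows "norm_1 (mode_mat nr nc f) = (MAX (k, d)\<in>{..<Nx} \<times> D. s_col Nx (mode_mat nr nc f) d k)"
  unfolding norm_1_def mode_mat_dim
proof (rule Max_image_eqI)
  have "0 < nc" using assms(1,2) by auto
  then show "{..<nc * Nx} \<noteq> {}" using Nx by (simp add: lessThan_empty_iff)
  show "finite ({..<Nx} \<times> D)" using assms(1) finite_subset by auto
  show "{..<Nx} \<times> D \<noteq> {}" using Nx assms(2) by auto
  fix c assume "c \<in> {..<nc * Nx}"
  then have c: "c mod Nx < Nx" "c div Nx < nc" using flat_less by auto
  obtain d where d: "d \<in> D" "(\<Sum>i<nr. cmod (f (c mod Nx) i (c div Nx))) \<le> (\<Sum>i<nr. cmod (f (c mod Nx) i d))"
    using dom[OF c] by blast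
  then have "d < nc" using assms(1) by auto
  then have "col_abs_sum (mode_mat nr nc f) (c div Nx * Nx + c mod Nx) \<le> s_col Nx (mode_mat nr nc f) d (c mod Nx)"
    unfolding s_col_def using c d(2) by (simp only: col_abs_sum_mode_mat)
  then show "\<exists>b\<in>{..<Nx} \<times> D. col_abs_sum (mode_mat nr nc f) c \<le> (case b of (k, d) \<Rightarrow> s_col Nx (mode_mat nr nc f) d k)"
    using c d(1) by (intro bexI[of _ "(c mod Nx, d)"]) simp_all
next
  fix b assume "b \<in> {..<Nx} \<times> D"
  then obtain k d where b: "b = (k, d)" "k < Nx" "d < nc" using assms(1) by auto
  then show "\<exists>c\<in>{..<nc * Nx}. (case b of (k, d) \<Rightarrow> s_col Nx (mode_mat nr nc f) d k) \<le> col_abs_sum (mode_mat nr nc f) c"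
    using flat_index[OF b(2,3)] by (intro bexI[of _ "d * Nx + k"]) (simp_all add: s_col_def)
qed simp

lemma norm_inf_mode_mat:
  assumes "D \<subseteq> {..<nr}" "D \<noteq> {}"
    and dom: "\<And>k d. k < Nx \<Longrightarrow> d < nr \<Longrightarrow> \<exists>d'\<in>D. (\<Sum>j<nc. cmod (f k d j)) \<le> (\<Sum>j<nc. cmod (f k d' j))"
  shows "norm_inf (mode_mat nr nc f) = (MAX (k, d)\<in>{..<Nx} \<times> D. s_row Nx (mode_mat nr nc f) d k)"
  unfolding norm_inf_def mode_mat_dim
proof (rule Max_image_eqI)
  have "0 < nr" using assms(1,2) by auto
  then show "{..<nr * Nx} \<noteq> {}" using Nx by (simp add: lessThan_empty_iff)
  show "finite ({..<Nx} \<times> D)" using assms(1) finite_subset by auto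
  show "{..<Nx} \<times> D \<noteq> {}" using Nx assms(2) by auto
  fix r assume "r \<in> {..<nr * Nx}"
  then have r: "r mod Nx < Nx" "r div Nx < nr" using flat_less by auto
  obtain d where d: "d \<in> D" "(\<Sum>j<nc. cmod (f (r mod Nx) (r div Nx) j)) \<le> (\<Sum>j<nc. cmod (f (r mod Nx) d j))"
    using dom[OF r] by blast
  then have "d < nr" using assms(1) by auto
  then have "row_abs_sum (mode_mat nr nc f) (r div Nx * Nx + r mod Nx) \<le> s_row Nx (mode_mat nr nc f) d (r mod Nx)"
    unfolding s_row_def using r d(2) by (simp only: row_abs_sum_mode_mat)
  then show "\<exists>b\<in>{..<Nx} \<times> D. row_abs_sum (mode_mat nr nc f) r \<le> (case b of (k, d) \<Rightarrow> s_row Nx (mode_mat nr nc f) d k)"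
    using r d(1) by (intro bexI[of _ "(r mod Nx, d)"]) simp_all
next
  fix b assume "b \<in> {..<Nx} \<times> D"
  then obtain k d where b: "b = (k, d)" "k < Nx" "d < nr" using assms(1) by auto
  then show "\<exists>r\<in>{..<nr * Nx}. (case b of (k, d) \<Rightarrow> s_row Nx (mode_mat nr nc f) d k) \<le> row_abs_sum (mode_mat nr nc f) r"
    using flat_index[OF b(2,3)] by (intro bexI[of _ "d * Nx + k"]) (simp_all add: s_row_def)
qed simp

lemma abs_sums_le_norms:
  assumes "k < Nx" "d < n"
  shows "(\<Sum>i<n. cmod (f k i d)) \<le> norm_1 (mode_mat n n f)"
    "(\<Sum>j<n. cmod (f k d j)) \<le> norm_inf (mode_mat n n f)"
  using flat_index[OF assms] unfolding norm_1_def norm_inf_def mode_mat_dim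
    col_abs_sum_mode_mat[OF assms, symmetric] row_abs_sum_mode_mat[OF assms, symmetric]
  by (auto intro!: Max_ge)

end

text \<open>For a square matrix the one unitarity relation yields the other, which gives
  orthonormality and completeness.\<close>

lemma unitary_mode_basis:
  assumes Nx: "1 \<le> Nx" and U: "U \<in> carrier_mat Nx Nx" "U * mat_adjoint U = 1\<^sub>m Nx"
  shows "mode_basis Nx (\<lambda>p k. U $$ (p, k))"
proof
  have adj: "mat_adjoint U \<in> carrier_mat Nx Nx" using U(1) by (auto simp: mat_adjoint_def)
  have adj_entry: "mat_adjoint U $$ (i, j) = cnj (U $$ (j, i))" if "i < Nx" "j < Nx" for i j
    using U(1) that by (simp add: mat_adjoint_def mat_of_rows_index)
  have U2: "mat_adjoint U * U = 1\<^sub>m Nx" by (rule mat_mult_left_right_inverse[OF U(1) adj U(2)])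
  show "0 < Nx" using Nx by simp
  fix p q assume pq: "p < Nx" "q < Nx"
  have "(\<Sum>k<Nx. cnj (U $$ (k, p)) * U $$ (k, q)) = (mat_adjoint U * U) $$ (p, q)"
    using pq U(1) adj by (simp add: scalar_prod_def atLeast0LessThan adj_entry)
  then show "(\<Sum>k<Nx. cnj (U $$ (k, p)) * U $$ (k, q)) = (if p = q then 1 else 0)"
    using U2 pq by simp
  have "(\<Sum>k<Nx. U $$ (p, k) * cnj (U $$ (q, k))) = (U * mat_adjoint U) $$ (p, q)"
    using pq U(1) adj by (simp add: scalar_prod_def atLeast0LessThan adj_entry)
  then show "(\<Sum>k<Nx. U $$ (p, k) * cnj (U $$ (q, k))) = (if p = q then 1 else 0)"
    using U(2) pq by simp
qed

lemma unitary_diag_entry: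
  assumes U: "U \<in> carrier_mat Nx Nx" and pq: "p < Nx" "q < Nx"
  shows "(U * mat_diag Nx f * mat_adjoint U) $$ (p, q) = (\<Sum>k<Nx. U $$ (p, k) * f k * cnj (U $$ (q, k)))"
proof -
  have adj: "mat_adjoint U \<in> carrier_mat Nx Nx" using U by (auto simp: mat_adjoint_def)
  have adj_entry: "mat_adjoint U $$ (i, j) = cnj (U $$ (j, i))" if "i < Nx" "j < Nx" for i j
    using U that by (simp add: mat_adjoint_def mat_of_rows_index)
  show ?thesis unfolding mat_diag_mult_right[OF U]
    using pq adj by (simp add: scalar_prod_def atLeast0LessThan adj_entry)
qed

section \<open>The convergence factor of the four-level method\<close>

theorem mainTheorem8:
  fixes Nx :: nat and m N :: "nat \<Rightarrow> nat"
    and \<Phi> :: "nat \<Rightarrow> complex mat" and U E :: "complex mat"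
    and lam :: "nat \<Rightarrow> nat \<Rightarrow> complex"
  assumes Nx: "Nx \<ge> 1"
    and m: "\<And>l. l < 3 \<Longrightarrow> m l \<ge> 1"
    and N: "\<And>l. l < 3 \<Longrightarrow> real (N (Suc l)) = (real (N l) - 1) / real (m l) + 1"
    and N3: "N 3 \<ge> 2"
    and U: "U \<in> carrier_mat Nx Nx" "U * mat_adjoint U = 1\<^sub>m Nx"
    and diag: "\<And>l. l \<le> 3 \<Longrightarrow> \<Phi> l = U * mat_diag Nx (lam l) * mat_adjoint U"
    and stable: "\<And>l k. l \<le> 3 \<Longrightarrow> k < Nx \<Longrightarrow> cmod (lam l k) < 1"
    and E: "E = E_coarse Nx m N (\<lambda>l. mat_diag Nx (lam l))"
  shows
    "(\<forall>e0 \<in> carrier_vec (N 0 * Nx).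
        conv_factor Nx m N \<Phi> e0 \<le> ereal (sqrt (norm_1 E * norm_inf E)))
     \<and> norm_1 E = (MAX (k, d)\<in>{..<Nx} \<times> {0..m 1 * m 2 - 1}. s_col Nx E d k)
     \<and> norm_inf E = (MAX (k, d)\<in>{..<Nx} \<times> {N 1 - m 1 * m 2..N 1 - 1}. s_row Nx E d k)
     \<and> (\<forall>k<Nx.
         s_col Nx E 0 k =
           cmod (lam 3 k) ^ (N 3 - 2) * \<alpha>\<^sub>3 m lam k
           + \<alpha>\<^sub>3 m lam k * geo lam k 3 (N 3 - 2) * geo lam k 2 (m 2) * geo lam k 1 (m 1)
           + \<alpha>\<^sub>2 m lam k * geo lam k 2 (m 2 - 1) * geo lam k 1 (m 1)
           + \<alpha>\<^sub>1 m lam k * geo lam k 1 (m 1 - 1))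
     \<and> (\<forall>k<Nx. \<forall>j. 1 \<le> j \<and> j < m 2 \<longrightarrow>
         s_col Nx E (m 1 * (m 2 - j)) k =
           \<alpha>\<^sub>2 m lam k * geo lam k 2 (j - 1) * geo lam k 1 (m 1)
           + \<alpha>\<^sub>1 m lam k * geo lam k 1 (m 1 - 1)
           + cmod (lam 2 k) ^ (j - 1) * \<alpha>\<^sub>2 m lam k *
               (cmod (lam 3 k) ^ (N 3 - 2)
                + geo lam k 3 (N 3 - 2) * geo lam k 2 (m 2) * geo lam k 1 (m 1)))
     \<and> (\<forall>k<Nx. \<forall>j r. j < m 2 \<and> r + 1 < m 1 \<longrightarrow>
         s_col Nx E (m 1 * (m 2 - j) - r - 1) k =
           \<alpha>\<^sub>1 m lam k *
             (cmod (lam 1 k) ^ r * geo lam k 1 (m 1) * geo lam k 2 j + geo lam k 1 r)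
           + cmod (lam 2 k) ^ j * cmod (lam 1 k) ^ r * \<alpha>\<^sub>1 m lam k *
               (cmod (lam 3 k) ^ (N 3 - 2)
                + geo lam k 3 (N 3 - 2) * geo lam k 2 (m 2) * geo lam k 1 (m 1)))
     \<and> (\<forall>k<Nx.
         s_row Nx E (N 1 - 1) k =
           geo lam k 3 (N 3 - 1) *
             (\<alpha>\<^sub>1 m lam k * geo lam k 2 (m 2) * geo lam k 1 (m 1 - 1)
              + \<alpha>\<^sub>2 m lam k * geo lam k 2 (m 2 - 1) + \<alpha>\<^sub>3 m lam k))
     \<and> (\<forall>k<Nx. \<forall>j. 1 \<le> j \<and> j < m 2 \<longrightarrow>
         s_row Nx E (N 1 - 1 - m 1 * m 2 + j * m 1) k =
           geo lam k 2 j * (\<alpha>\<^sub>1 m lam k * geo lam k 1 (m 1 - 1) + \<alpha>\<^sub>2 m lam k)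
           + cmod (lam 2 k) ^ j * geo lam k 3 (N 3 - 2) *
               (\<alpha>\<^sub>1 m lam k * geo lam k 2 (m 2) * geo lam k 1 (m 1 - 1)
                + \<alpha>\<^sub>2 m lam k * geo lam k 2 (m 2 - 1) + \<alpha>\<^sub>3 m lam k))
     \<and> (\<forall>k<Nx. \<forall>j r. j < m 2 \<and> 1 \<le> r \<and> r < m 1 \<longrightarrow>
         s_row Nx E (N 1 - 1 - m 1 * m 2 + r + j * m 1) k =
           cmod (lam 1 k) ^ r * cmod (lam 2 k) ^ j * geo lam k 3 (N 3 - 2) *
             (\<alpha>\<^sub>2 m lam k * geo lam k 2 (m 2 - 1) + \<alpha>\<^sub>3 m lam k)
           + cmod (lam 1 k) ^ r * geo lam k 2 j *
               (\<alpha>\<^sub>2 m lam k + \<alpha>\<^sub>1 m lam k * geo lam k 1 (m 1 - 1))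
           + cmod (lam 1 k) ^ r * cmod (lam 2 k) ^ j * \<alpha>\<^sub>1 m lam k * geo lam k 3 (N 3 - 2) *
               geo lam k 2 (m 2) * geo lam k 1 (m 1 - 1)
           + \<alpha>\<^sub>1 m lam k * geo lam k 1 r)"
proof -
  \<comment> \<open>Solved for \<open>N l\<close>, the real equation becomes one between naturals
    without truncation as soon as \<open>N (Suc l)\<close> is positive. Positivity thus climbs from
    the coarsest level to the finest.\<close>
  have N_pos_eq: "1 \<le> N l \<and> N l = m l * (N (Suc l) - 1) + 1" if "l < 3" "1 \<le> N (Suc l)" for l
  proof -
    have "real (N l) = real (m l) * (real (N (Suc l)) - 1) + 1"
      using N[OF that(1)] m[OF that(1)] by simp
    then have "real (N l) = real (m l * (N (Suc l) - 1) + 1)" using that(2) by (simp add: of_nat_diff)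
    then show ?thesis by linarith
  qed
  have N2: "1 \<le> N 2" "N 2 = m 2 * (N 3 - 1) + 1" using N_pos_eq[of 2] N3 by simp_all
  have N1: "1 \<le> N 1" "N 1 = m 1 * (N 2 - 1) + 1" using N_pos_eq[of 1] N2(1) by (simp_all add: numeral_2_eq_2)
  have N0: "1 \<le> N 0" "N 0 = m 0 * (N 1 - 1) + 1" using N_pos_eq[of 0] N1(1) by simp_all
  have three: "l \<in> {0, 1, 2}" if "l < 3" for l :: nat using that by auto
  have N_pos: "1 \<le> N l" if "l \<le> 3" for l
    using that three[of l] N0(1) N1(1) N2(1) N3 by (cases "l = 3") auto
  have N_eq: "N l = m l * (N (Suc l) - 1) + 1" if "l < 3" for l
    using N_pos_eq[OF that] N_pos[of "Suc l"] that by simp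
  let ?u = "\<lambda>p k::nat. if p = k then 1 else (0::complex)"
  have grid: "time_grid_axioms Nx v m N \<Psi> lam"
    if "\<And>l. l \<le> 3 \<Longrightarrow> \<Psi> l \<in> carrier_mat Nx Nx"
      "\<And>l p q. l \<le> 3 \<Longrightarrow> p < Nx \<Longrightarrow> q < Nx \<Longrightarrow> \<Psi> l $$ (p, q) = (\<Sum>k<Nx. v p k * lam l k * cnj (v q k))"
    for v \<Psi>
    by unfold_locales (use m N_pos N_eq that in blast)+
  \<comment> \<open>\<open>D\<close> describes the diagonalized operators from which
    \<open>E\<close> is formed.\<close>
  interpret D: unit_basis Nx ?u
    using Nx by unfold_locales (auto simp: if_distrib[of "\<lambda>x. x * _"] if_distrib[of "\<lambda>x. _ * x"] if_distrib[of cnj] cong: if_cong)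
  interpret D: time_grid Nx ?u m N "\<lambda>l. mat_diag Nx (lam l)" lam
    by (intro time_grid.intro D.mode_basis_axioms grid)
      (auto simp: mat_diag_def if_distrib[of "\<lambda>x. x * _"] if_distrib[of "\<lambda>x. _ * x"] if_distrib[of cnj] cong: if_cong)
  \<comment> \<open>\<open>G\<close> describes the actual iteration with the given matrices
    \<open>\<Phi>\<close>.\<close>
  interpret G: time_grid Nx "\<lambda>p k. U $$ (p, k)" m N \<Phi> lam
  proof (intro time_grid.intro unitary_mode_basis[OF Nx U] grid)
    fix l :: nat assume l: "l \<le> 3"
    have "mat_adjoint U \<in> carrier_mat Nx Nx" using U(1) by (auto simp: mat_adjoint_def)
    then show "\<Phi> l \<in> carrier_mat Nx Nx" unfolding diag[OF l] using U(1) by auto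
    show "\<Phi> l $$ (p, q) = (\<Sum>k<Nx. U $$ (p, k) * lam l k * cnj (U $$ (q, k)))" if "p < Nx" "q < Nx" for p q
      unfolding diag[OF l] by (rule unitary_diag_entry[OF U(1) that])
  qed
  \<comment> \<open>The number of intervals between points of the coarsest level, and also the index
    of its last point.\<close>
  define K where "K = N 3 - 1"
  have K: "1 \<le> K" "K - 1 = N 3 - 2" using N3 by (simp_all add: K_def)
  have N1K: "N 1 = m 1 * (m 2 * K) + 1" using N1(2) N2(2) by (simp add: K_def)
  have m12: "1 \<le> m 1" "1 \<le> m 2" using m by simp_all
  have tg: "three_grid (m 1) (m 2) K" by (rule three_grid.intro) (use m12 K in auto)
  have N1_pos: "0 < N 1" using N1(1) by simp
  have E_mode: "E = D.mode_mat (N 1) (N 1) D.propagator" unfolding E by (rule D.E_coarse_mode)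
  have prop_eq: "D.propagator k = err_prop (lam 0 k ^ m 0)
      (cyc_inv (m 1) (lam 1 k) (cyc_inv (m 2) (lam 2 k) (seq_inv (lam 3 k))))" for k
    by (simp add: D.propagator_def D.cycle_def)
  have col: "(\<Sum>i<N 1. cmod (D.propagator k i d)) = col_weight 1 (m 1 * (m 2 * K)) (D.propagator k) d" for k d
    by (simp only: N1K col_weight_1 lessThan_Suc_atMost flip: Suc_eq_plus1)
  have row: "(\<Sum>j<N 1. cmod (D.propagator k d j)) = row_init (D.propagator k) d" if "d < N 1" for k d
    unfolding row_init_def prop_eq using that
    by (intro sum.mono_neutral_right) (auto simp: err_prop_def)
  \<comment> \<open>As \<open>K\<close> is positive, a full period of columns or rows fits into
    level 1.\<close>
  have p: "0 < m 1 * m 2" "m 1 * m 2 < N 1"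
  proof -
    have "m 1 * (m 2 * 1) \<le> m 1 * (m 2 * K)" using K(1) by (intro mult_le_mono2)
    then show "m 1 * m 2 < N 1" unfolding N1K mult_1_right by linarith
  qed (use m12 in simp)
  have s_col: "s_col Nx E d k = col_weight 1 (m 1 * (m 2 * K)) (D.propagator k) d" if "k < Nx" "d < N 1" for k d
    unfolding s_col_def E_mode D.col_abs_sum_mode_mat[OF that] by (rule col)
  have s_row: "s_row Nx E d k = row_init (D.propagator k) d" if "k < Nx" "d < N 1" for k d
    unfolding s_row_def E_mode D.row_abs_sum_mode_mat[OF that] by (rule row[OF that(2)])
  have geo: "geo lam k l n = gsum (cmod (lam l k)) n" if "l \<le> 3" "k < Nx" for k l n
    using stable[OF that] by (simp add: geo_def gsum_closed)
  have norm_1: "norm_1 E = (MAX (k, d)\<in>{..<Nx} \<times> {0..m 1 * m 2 - 1}. s_col Nx E d k)"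
    unfolding E_mode
  proof (rule D.norm_1_mode_mat)
    fix k d assume d: "d < N 1"
    have "\<exists>i<m 1 * m 2. i < N 1 \<and> col_weight 1 (m 1 * (m 2 * K)) (D.propagator k) d
        \<le> col_weight 1 (m 1 * (m 2 * K)) (D.propagator k) i"
    proof (rule Max_period_first[OF _ p(1) d])
      fix j assume "j + m 1 * m 2 < N 1"
      then have "j + m 1 * m 2 \<le> m 1 * (m 2 * K)" using N1K by linarith
      then show "col_weight 1 (m 1 * (m 2 * K)) (D.propagator k) (j + m 1 * m 2)
          \<le> col_weight 1 (m 1 * (m 2 * K)) (D.propagator k) j"
        unfolding prop_eq by (rule three_grid.col_mono[OF tg])
    qed
    then obtain i where i: "i < m 1 * m 2" "col_weight 1 (m 1 * (m 2 * K)) (D.propagator k) d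
        \<le> col_weight 1 (m 1 * (m 2 * K)) (D.propagator k) i" by blast
    from i(1) have "i \<in> {0..m 1 * m 2 - 1}" unfolding atLeastAtMost_iff by linarith
    with i(2) show "\<exists>d'\<in>{0..m 1 * m 2 - 1}. (\<Sum>i<N 1. cmod (D.propagator k i d)) \<le> (\<Sum>i<N 1. cmod (D.propagator k i d'))"
      unfolding col by (rule bexI)
  qed (use p in auto)
  have norm_inf: "norm_inf E = (MAX (k, d)\<in>{..<Nx} \<times> {N 1 - m 1 * m 2..N 1 - 1}. s_row Nx E d k)"
    unfolding E_mode
  proof (rule D.norm_inf_mode_mat)
    fix k d assume d: "d < N 1"
    have "\<exists>i. N 1 - m 1 * m 2 \<le> i \<and> i < N 1 \<and> row_init (D.propagator k) d \<le> row_init (D.propagator k) i"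
      using Max_period_last[OF _ p(1) d, of "row_init (D.propagator k)"] three_grid.row_mono[OF tg]
      unfolding prop_eq by blast
    then obtain i where i: "N 1 - m 1 * m 2 \<le> i" "i < N 1"
      "row_init (D.propagator k) d \<le> row_init (D.propagator k) i" by blast
    then show "\<exists>d'\<in>{N 1 - m 1 * m 2..N 1 - 1}. (\<Sum>j<N 1. cmod (D.propagator k d j)) \<le> (\<Sum>j<N 1. cmod (D.propagator k d' j))"
      using row[OF d, of k] row[OF i(2), of k] by (intro bexI[of _ i]) auto
  next
    have "N 1 - m 1 * m 2 \<le> N 1 - 1" using p by linarith
    then show "{N 1 - m 1 * m 2..N 1 - 1} \<noteq> {}" by simp
    show "{N 1 - m 1 * m 2..N 1 - 1} \<subseteq> {..<N 1}" using N1_pos by auto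
  qed
  have nonneg: "0 \<le> norm_1 E" "0 \<le> norm_inf E"
  proof -
    have "0 \<le> (\<Sum>i<N 1. cmod (D.propagator 0 i 0))" "0 \<le> (\<Sum>j<N 1. cmod (D.propagator 0 0 j))"
      by (simp_all add: sum_nonneg)
    moreover have "0 < Nx" "0 < N 1" using Nx N1(1) by simp_all
    ultimately show "0 \<le> norm_1 E" "0 \<le> norm_inf E"
      unfolding E_mode using D.abs_sums_le_norms[of 0 0 "N 1" D.propagator] order_trans by blast+
  qed
  have conv: "conv_factor Nx m N \<Phi> e0 \<le> ereal (sqrt (norm_1 E * norm_inf E))"
    if "e0 \<in> carrier_vec (N 0 * Nx)" for e0
    \<comment> \<open>\<open>propagator\<close> depends only on \<open>m\<close> and
      \<open>lam\<close>, not on the basis, so the sums bounded by the norms of \<open>E\<close> are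
      also those of the iteration in the basis of \<open>U\<close>.\<close>
    unfolding E_mode by (intro G.conv_factor_le that D.abs_sums_le_norms nonneg[unfolded E_mode])
  note alphas = \<alpha>\<^sub>1_def \<alpha>\<^sub>2_def \<alpha>\<^sub>3_def
  have col_first: "s_col Nx E 0 k = cmod (lam 3 k) ^ (N 3 - 2) * \<alpha>\<^sub>3 m lam k
           + \<alpha>\<^sub>3 m lam k * geo lam k 3 (N 3 - 2) * geo lam k 2 (m 2) * geo lam k 1 (m 1)
           + \<alpha>\<^sub>2 m lam k * geo lam k 2 (m 2 - 1) * geo lam k 1 (m 1)
           + \<alpha>\<^sub>1 m lam k * geo lam k 1 (m 1 - 1)" if k: "k < Nx" for k
    unfolding s_col[OF k N1_pos] prop_eq three_grid.col_first[OF tg] K(2) alphas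
    using k by (simp add: geo)
  have mult_lt: "m 1 * c < N 1" if "c \<le> m 2" for c
    using p(2) mult_le_mono2[OF that, of "m 1"] by linarith
  have col_C: "s_col Nx E (m 1 * (m 2 - j)) k =
           \<alpha>\<^sub>2 m lam k * geo lam k 2 (j - 1) * geo lam k 1 (m 1)
           + \<alpha>\<^sub>1 m lam k * geo lam k 1 (m 1 - 1)
           + cmod (lam 2 k) ^ (j - 1) * \<alpha>\<^sub>2 m lam k *
               (cmod (lam 3 k) ^ (N 3 - 2)
                + geo lam k 3 (N 3 - 2) * geo lam k 2 (m 2) * geo lam k 1 (m 1))"
    if k: "k < Nx" and j: "1 \<le> j" "j < m 2" for k j
    unfolding s_col[OF k mult_lt[OF diff_le_self]] prop_eq three_grid.col_C[OF tg j] K(2) alphas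
    using k by (simp add: geo)
  have col_F: "s_col Nx E (m 1 * (m 2 - j) - r - 1) k =
           \<alpha>\<^sub>1 m lam k *
             (cmod (lam 1 k) ^ r * geo lam k 1 (m 1) * geo lam k 2 j + geo lam k 1 r)
           + cmod (lam 2 k) ^ j * cmod (lam 1 k) ^ r * \<alpha>\<^sub>1 m lam k *
               (cmod (lam 3 k) ^ (N 3 - 2)
                + geo lam k 3 (N 3 - 2) * geo lam k 2 (m 2) * geo lam k 1 (m 1))"
    if k: "k < Nx" and j: "j < m 2" "r + 1 < m 1" for k j r
  proof -
    have "m 1 * (m 2 - j) - r - 1 < N 1" using mult_lt[of "m 2 - j"] by simp
    from s_col[OF k this] show ?thesis
      unfolding prop_eq three_grid.col_F[OF tg j] K(2) alphas using k by (simp add: geo)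
  qed
  have row_last: "s_row Nx E (N 1 - 1) k =
           geo lam k 3 (N 3 - 1) *
             (\<alpha>\<^sub>1 m lam k * geo lam k 2 (m 2) * geo lam k 1 (m 1 - 1)
              + \<alpha>\<^sub>2 m lam k * geo lam k 2 (m 2 - 1) + \<alpha>\<^sub>3 m lam k)" if k: "k < Nx" for k
  proof -
    have "N 1 - 1 < N 1" "N 1 - 1 = m 1 * (m 2 * K)" using N1K by simp_all
    then show ?thesis using s_row[OF k, of "N 1 - 1"] three_grid.row_last[OF tg] k
      by (simp add: prop_eq geo K_def alphas)
  qed
  have row_interval: "s_row Nx E (N 1 - 1 - m 1 * m 2 + r + j * m 1) k =
      \<alpha>\<^sub>1 m lam k * geo lam k 1 r + cmod (lam 1 k) ^ r * (
      geo lam k 2 j * (\<alpha>\<^sub>1 m lam k * geo lam k 1 (m 1 - 1) + \<alpha>\<^sub>2 m lam k)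
      + cmod (lam 2 k) ^ j * geo lam k 3 (N 3 - 2) *
        (\<alpha>\<^sub>1 m lam k * geo lam k 2 (m 2) * geo lam k 1 (m 1 - 1)
          + \<alpha>\<^sub>2 m lam k * geo lam k 2 (m 2 - 1) + \<alpha>\<^sub>3 m lam k))"
    if k: "k < Nx" and jr: "j < m 2" "r < m 1" for k j r
  proof -
    \<comment> \<open>Cutting off the last coarsest interval puts the row index into the coordinates
      \<open>K - 1\<close>, \<open>j\<close>, \<open>r\<close> of
      \<open>three_grid.row_interval\<close>.\<close>
    have split: "m 1 * (m 2 * K) = m 1 * m 2 + m 1 * (m 2 * (K - 1))"
      using K(1) by (cases K) (simp_all add: distrib_left)
    then have d: "N 1 - 1 - m 1 * m 2 + r + j * m 1 = m 1 * (m 2 * (K - 1) + j) + r"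
      using N1K by (simp add: algebra_simps)
    have "m 1 * (m 2 * (K - 1) + j) + r < N 1"
    proof -
      have "m 1 * Suc j \<le> m 1 * m 2" using jr by (intro mult_le_mono2) simp
      then show ?thesis using jr N1K split by (simp add: distrib_left)
    qed
    from s_row[OF k this] show ?thesis
      unfolding d prop_eq three_grid.row_interval[OF tg jr] unfolding K(2) alphas using k by (simp add: geo)
  qed
  show ?thesis
  proof (intro conjI allI impI ballI)
    fix k j assume "k < Nx" "1 \<le> j \<and> j < m 2"
    then show "s_row Nx E (N 1 - 1 - m 1 * m 2 + j * m 1) k =
           geo lam k 2 j * (\<alpha>\<^sub>1 m lam k * geo lam k 1 (m 1 - 1) + \<alpha>\<^sub>2 m lam k)
           + cmod (lam 2 k) ^ j * geo lam k 3 (N 3 - 2) *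
               (\<alpha>\<^sub>1 m lam k * geo lam k 2 (m 2) * geo lam k 1 (m 1 - 1)
                + \<alpha>\<^sub>2 m lam k * geo lam k 2 (m 2 - 1) + \<alpha>\<^sub>3 m lam k)"
      \<comment> \<open>At offset 0 the power of \<open>lam 1\<close> is 1 and the term with
        \<open>geo lam k 1 0\<close> vanishes.\<close>
      using row_interval[of k j 0] m12 by (simp add: geo)
  next
    fix k j r assume "k < Nx" "j < m 2 \<and> 1 \<le> r \<and> r < m 1"
    then show "s_row Nx E (N 1 - 1 - m 1 * m 2 + r + j * m 1) k =
           cmod (lam 1 k) ^ r * cmod (lam 2 k) ^ j * geo lam k 3 (N 3 - 2) *
             (\<alpha>\<^sub>2 m lam k * geo lam k 2 (m 2 - 1) + \<alpha>\<^sub>3 m lam k)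
           + cmod (lam 1 k) ^ r * geo lam k 2 j *
               (\<alpha>\<^sub>2 m lam k + \<alpha>\<^sub>1 m lam k * geo lam k 1 (m 1 - 1))
           + cmod (lam 1 k) ^ r * cmod (lam 2 k) ^ j * \<alpha>\<^sub>1 m lam k * geo lam k 3 (N 3 - 2) *
               geo lam k 2 (m 2) * geo lam k 1 (m 1 - 1)
           + \<alpha>\<^sub>1 m lam k * geo lam k 1 r"
      using row_interval[of k j r] by (simp add: distrib_left distrib_right mult.assoc mult.left_commute mult.commute)
  qed (use conv norm_1 norm_inf col_first col_C col_F row_last in blast)+
qed

end
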